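(* Let $\mathcal{P}_0$ denote the distribution of the adjacency matrix of the Erdős–Rényi graph ${\sf ER}(n,\frac{k}{n-1})$ and, for $\pi\in S_{n-1}$, let $\mathcal{P}_\pi$ denote the distribution of the adjacency matrix of the Watts–Strogatz graph ${\sf WS}(n,k,\beta)$ with hidden permutation $\pi$ (all defined in the context), where $k=k(n)\to\infty$ as $n\to\infty$ and $\beta=\beta(n)$. There exist universal constants $c,C>0$ such that the spectral (second eigenvalue) test $\phi_2$, defined by $\phi_2(A)=1$ if $\lambda_2(A)\ge C\left(\sqrt k\vee\sqrt{\log n}\right)$ and $\phi_2(A)=0$ otherwise, satisfies $$\lim_{n,k(n)\to\infty}\ \max\left\{\mathcal{P}_0(\phi_2\neq0),\ \frac{1}{(n-1)!}\sum_{\pi\in S_{n-1}}\mathcal{P}_\pi(\phi_2\neq1)\right\}=0$$ whenever $$1-\beta\ \ge\ c\left(\sqrt{\frac1k}\vee\frac{\sqrt{\log n}}{k}\right)\quad\text{for all sufficiently large } n.$$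
   Context: Parameters: $n$ is the number of nodes, $k$ (even) the neighborhood size, $\beta\in[0,1]$ the rewiring probability. Ring lattice matrix: $B\in\{0,1\}^{n\times n}$ is given by $B_{ij}=1$ if $i\ne j$ and the ring (circular) distance $\min(|i-j|,n-|i-j|)$ is at most $k/2$, and $B_{ij}=0$ otherwise. For a permutation $\pi$ of the $n$ nodes with permutation matrix $P_\pi$, the convention is $[P_\pi B P_\pi^T]_{ij}=B_{\pi^{-1}(i)\pi^{-1}(j)}$. ${\sf WS}(n,k,\beta)$ with hidden permutation $\pi$: the symmetric random adjacency matrix $A\in\{0,1\}^{n\times n}$ with zero diagonal whose entries $A_{ij}$, $i<j$, are independent, with $A_{ij}\sim{\sf Bernoulli}\left(1-\beta(1-\beta\frac{k}{n-1})\right)$ if $[P_\pi BP_\pi^T]_{ij}=1$ and $A_{ij}\sim{\sf Bernoulli}\left(\beta\frac{k}{n-1}\right)$ if $[P_\pi BP_\pi^T]_{ij}=0$. ${\sf ER}(n,\frac{k}{n-1})$: symmetric $A$ with zero diagonal and $A_{ij}$, $i<j$, i.i.d. ${\sf Bernoulli}(\frac{k}{n-1})$. $S_{n-1}$ (with $(n-1)!$ elements) is viewed as the set of permutations of the $n$ nodes fixing one designated node. $\lambda_2(A)$ is the second largest eigenvalue of the symmetric matrix $A$; $a\vee b=\max(a,b)$.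
   Formalization: Added assumption: k(n) ≤ ρn for all large n with a fixed ρ<1; C is universal but c may depend on ρ (ρ=1/2 gives universal c, C for k ≤ n/2). Without a bound on k the claim fails: for k the largest even number ≤ n−1 and β=0, λ₂ ≤ 0, so the test never rejects. *)

theory Defs
  imports
    "HOL-Probability.Probability"
    "HOL-Combinatorics.Permutations"
    "Jordan_Normal_Form.Char_Poly"
begin

text \<open>Nodes are \<open>0, \<dots>, n - 1\<close>; matrices are the dimension-indexed ones of \<open>Jordan_Normal_Form\<close>.\<close>

text \<open>Subtraction on naturals does not truncate here as long as \<open>i, j < n\<close>.\<close>

definition ring_dist :: "nat \<Rightarrow> nat \<Rightarrow> nat \<Rightarrow> nat" where
  "ring_dist n i j = (let d = nat \<bar>int i - int j\<bar> in min d (n - d))"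

definition ring_lattice :: "nat \<Rightarrow> nat \<Rightarrow> real mat" where
  "ring_lattice n k =
     mat n n (\<lambda>(i, j). if i \<noteq> j \<and> real (ring_dist n i j) \<le> real k / 2 then 1 else 0)"

text \<open>The matrix \<open>P\<^sub>\<pi> B P\<^sub>\<pi>\<^sup>T\<close>, with the convention that its \<open>(i, j)\<close> entry is
  \<open>B\<close> at \<open>(\<pi>\<inverse>(i), \<pi>\<inverse>(j))\<close>.\<close>

definition relabel_mat :: "nat \<Rightarrow> (nat \<Rightarrow> nat) \<Rightarrow> 'a mat \<Rightarrow> 'a mat" where
  "relabel_mat n \<pi> B = mat n n (\<lambda>(i, j). B $$ (inv_into UNIV \<pi> i, inv_into UNIV \<pi> j))"

definition upper_pairs :: "nat \<Rightarrow> (nat \<times> nat) set" where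
  "upper_pairs n = {(i, j). i < j \<and> j < n}"

definition sym_adj_mat :: "nat \<Rightarrow> (nat \<times> nat \<Rightarrow> bool) \<Rightarrow> real mat" where
  "sym_adj_mat n e =
     mat n n (\<lambda>(i, j). if i = j then 0 else of_bool (e (min i j, max i j)))"

text \<open>Independent entries above the diagonal, the \<open>(i, j)\<close> entry being Bernoulli with parameter
  \<open>q i j\<close>. Note that \<open>bernoulli_pmf\<close> truncates its parameter to \<open>[0, 1]\<close>; for \<open>k \<le> n - 1\<close> and
  \<open>0 \<le> \<beta> \<le> 1\<close> all parameters below already lie in this interval.\<close>

definition sym_bernoulli_pmf :: "nat \<Rightarrow> (nat \<Rightarrow> nat \<Rightarrow> real) \<Rightarrow> real mat pmf" where
  "sym_bernoulli_pmf n q =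
     map_pmf (sym_adj_mat n) (Pi_pmf (upper_pairs n) False (\<lambda>(i, j). bernoulli_pmf (q i j)))"

definition er_pmf :: "nat \<Rightarrow> real \<Rightarrow> real mat pmf" where
  "er_pmf n p = sym_bernoulli_pmf n (\<lambda>i j. p)"

definition ws_pmf :: "nat \<Rightarrow> nat \<Rightarrow> real \<Rightarrow> (nat \<Rightarrow> nat) \<Rightarrow> real mat pmf" where
  "ws_pmf n k \<beta> \<pi> =
     sym_bernoulli_pmf n (\<lambda>i j.
       if relabel_mat n \<pi> (ring_lattice n k) $$ (i, j) = 1
       then 1 - \<beta> * (1 - \<beta> * (real k / (real n - 1)))
       else \<beta> * (real k / (real n - 1)))"

text \<open>The permutations of the nodes that fix node \<open>0\<close>; there are \<open>(n - 1)!\<close> of them if \<open>n \<ge> 1\<close>.\<close>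

definition hidden_perms :: "nat \<Rightarrow> (nat \<Rightarrow> nat) set" where
  "hidden_perms n = {\<pi>. \<pi> permutes {..<n} \<and> \<pi> 0 = 0}"

text \<open>Second largest eigenvalue, counted with multiplicity. This is meant for symmetric real
  matrices of dimension at least \<open>2\<close>, whose characteristic polynomial splits over the reals.\<close>

definition second_eigenvalue :: "real mat \<Rightarrow> real" where
  "second_eigenvalue A = rev (sorted_list_of_multiset (proots (char_poly A))) ! 1"

definition spectral_test :: "real \<Rightarrow> nat \<Rightarrow> nat \<Rightarrow> real mat \<Rightarrow> nat" where
  "spectral_test C n k A =
     (if second_eigenvalue A \<ge> C * max (sqrt (real k)) (sqrt (ln (real n))) then 1 else 0)"

end

theory Submission
  imports Defs "HOL-Real_Asymp.Real_Asymp"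
begin

text \<open>
  Under the null hypothesis \<open>\<lambda>\<^sub>2(A)\<close> is at most the largest value of the quadratic form of the
  centred matrix \<open>M\<close> on the unit sphere (test on vectors orthogonal to the all-ones vector), so it
  suffices to bound the expectation of \<open>tr M\<^sup>2\<^sup>m\<close> with \<open>m\<close> about \<open>k + ln n\<close>. As in Bandeira and van
  Handel's argument, the sum over closed walks is compared, walk shape by walk shape, with the
  same sum for a matrix of dimension only \<open>r = k + m\<close> whose independent entries are \<open>2\<close> and \<open>-1\<close>
  with probabilities \<open>1/3\<close> and \<open>2/3\<close>: these are centred, and all their higher moments are at
  least \<open>1\<close>. For that matrix \<open>r\<close> and \<open>m\<close> are of the same order, and an exponentially large net
  together with subgaussian moments gives \<open>(C m)\<^sup>m\<close>.

  Under the alternative it suffices to exhibit a plane on which the form of \<open>A\<close> is large. The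
  vectors that are constant on each of two complementary half arcs of the hidden ring form such
  a plane: only \<open>O(k\<^sup>2)\<close> of the \<open>n k / 2\<close> lattice edges join the two arcs. Only three scalar
  fluctuations have to be controlled there.
\<close>

subsection \<open>Spectral theorem for real symmetric matrices\<close>

text \<open>A net argument on the centred Erdos-Renyi matrix itself cannot give the order
  \<open>sqrt k\<close>: Hoeffding-type bounds see only the range 1 of the entries and not their
  variance, about \<open>k / n\<close>, and so yield \<open>sqrt n\<close>. In dimension
  \<open>k + m\<close> the entries are dense, and range and variance agree up to constants. The
  choice of \<open>m\<close> pays for every loss: \<open>m >= ln n\<close> turns the factor
  \<open>n\<close> of the trace into at most \<open>e ^ m\<close>, and \<open>m >= k\<close> turns
  the size of the net, exponential in \<open>k + m\<close>, into the \<open>m\<close>-th power of a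
  constant. Constants are generous, since the threshold may carry any absolute one. Under the
  alternative a fixed plane avoids any norm bound for the Watts-Strogatz noise: a unit vector of the
  plane is spread evenly over about \<open>n\<close> nodes, so the noise moves the form by a
  constant order only, far below \<open>sqrt k\<close>.\<close>

definition dotp :: "nat \<Rightarrow> (nat \<Rightarrow> real) \<Rightarrow> (nat \<Rightarrow> real) \<Rightarrow> real" where
  "dotp n x y = (\<Sum>i<n. x i * y i)"

text \<open>Vectors and matrices are total functions of which only the entries below
  \<open>n\<close> count. This suits compactness, walks and random entries alike;
  \<open>mat n n\<close> returns only for \<open>second_eigenvalue\<close>.\<close>

definition mulv :: "nat \<Rightarrow> (nat \<Rightarrow> nat \<Rightarrow> real) \<Rightarrow> (nat \<Rightarrow> real) \<Rightarrow> nat \<Rightarrow> real" where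
  "mulv n M x = (\<lambda>i. \<Sum>j<n. M i j * x j)"

definition symm :: "nat \<Rightarrow> (nat \<Rightarrow> nat \<Rightarrow> real) \<Rightarrow> bool" where
  "symm n M \<longleftrightarrow> (\<forall>i<n. \<forall>j<n. M i j = M j i)"

lemma dotp_commute: "dotp n x y = dotp n y x"
  by (simp add: dotp_def mult.commute)

lemma dotp_add_right: "dotp n x (\<lambda>i. y i + z i) = dotp n x y + dotp n x z"
  by (simp add: dotp_def algebra_simps sum.distrib)

lemma dotp_diff_right: "dotp n x (\<lambda>i. y i - z i) = dotp n x y - dotp n x z"
  by (simp add: dotp_def algebra_simps sum_subtractf)

lemma dotp_scale_right: "dotp n x (\<lambda>i. c * y i) = c * dotp n x y"
  by (simp add: dotp_def sum_distrib_left algebra_simps)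

lemma dotp_sum_right: "dotp n x (\<lambda>i. \<Sum>a\<in>A. f a i) = (\<Sum>a\<in>A. dotp n x (f a))"
  by (subst (2) dotp_def, subst sum.swap) (simp add: dotp_def sum_distrib_left)

lemma dotp_add_left: "dotp n (\<lambda>i. y i + z i) x = dotp n y x + dotp n z x"
  and dotp_diff_left: "dotp n (\<lambda>i. y i - z i) x = dotp n y x - dotp n z x"
  and dotp_scale_left: "dotp n (\<lambda>i. c * y i) x = c * dotp n y x"
  and dotp_sum_left: "dotp n (\<lambda>i. \<Sum>a\<in>A. f a i) x = (\<Sum>a\<in>A. dotp n (f a) x)"
  by (simp_all add: dotp_commute[of n _ x] dotp_add_right dotp_diff_right dotp_scale_right
        dotp_sum_right)

lemmas dotp_linear = dotp_add_right dotp_diff_right dotp_scale_right dotp_sum_right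
  dotp_add_left dotp_diff_left dotp_scale_left dotp_sum_left

lemma dotp_cong: "(\<And>i. i < n \<Longrightarrow> x i = x' i) \<Longrightarrow> (\<And>i. i < n \<Longrightarrow> y i = y' i) \<Longrightarrow> dotp n x y = dotp n x' y'"
  by (simp add: dotp_def)

lemma dotp_nonneg: "0 \<le> dotp n x x"
  by (simp add: dotp_def sum_nonneg)

lemma dotp_eq_0_iff: "dotp n x x = 0 \<longleftrightarrow> (\<forall>i<n. x i = 0)"
  unfolding dotp_def by (subst sum_nonneg_eq_0_iff) auto

lemma square_le_dotp: "i < n \<Longrightarrow> x i ^ 2 \<le> dotp n x x"
  unfolding dotp_def power2_eq_square by (rule member_le_sum) auto

lemma mulv_add: "mulv n M (\<lambda>i. x i + y i) = (\<lambda>i. mulv n M x i + mulv n M y i)"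
  by (simp add: mulv_def algebra_simps sum.distrib)

lemma mulv_scale: "mulv n M (\<lambda>i. c * x i) = (\<lambda>i. c * mulv n M x i)"
  by (simp add: mulv_def sum_distrib_left algebra_simps)

lemma mulv_cong: "(\<And>i. i < n \<Longrightarrow> x i = y i) \<Longrightarrow> mulv n M x = mulv n M y"
  by (simp add: mulv_def)

lemma symm_dotp_mulv:
  assumes "symm n M"
  shows "dotp n x (mulv n M y) = dotp n (mulv n M x) y"
proof -
  have "dotp n x (mulv n M y) = (\<Sum>i<n. \<Sum>j<n. M i j * x i * y j)"
    by (simp add: dotp_def mulv_def sum_distrib_left algebra_simps)
  also have "\<dots> = (\<Sum>j<n. \<Sum>i<n. M j i * x i * y j)"
    by (subst sum.swap) (use assms in \<open>simp add: symm_def\<close>)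
  also have "\<dots> = dotp n (mulv n M x) y"
    by (simp add: dotp_def mulv_def sum_distrib_left mult_ac)
  finally show ?thesis .
qed

lemma dotp_unit: "i < n \<Longrightarrow> dotp n x (\<lambda>j. of_bool (j = i)) = x i"
  and dotp_unit_left: "i < n \<Longrightarrow> dotp n (\<lambda>j. of_bool (j = i)) x = x i"
  by (simp_all add: dotp_def)

text \<open>The residual of the unit vector at \<open>i\<close> after projecting off an orthonormal family has squared
  length \<open>1 - (\<Sum>a. (v a i)\<^sup>2)\<close>; counting dimensions is summing this over \<open>i\<close>.\<close>

lemma orthonormal_residual:
  fixes v :: "nat \<Rightarrow> nat \<Rightarrow> real"
  assumes "\<And>a b. a < k \<Longrightarrow> b < k \<Longrightarrow> dotp n (v a) (v b) = of_bool (a = b)" and "i < n"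
  defines "r \<equiv> \<lambda>j. of_bool (j = i) - (\<Sum>a<k. v a i * v a j)"
  shows "a < k \<Longrightarrow> dotp n (v a) r = 0" and "dotp n r r = 1 - (\<Sum>a<k. v a i ^ 2)"
proof -
  have 1: "dotp n (v a) r = 0" if "a < k" for a
  proof -
    have "dotp n (v a) r = v a i - (\<Sum>b<k. v b i * of_bool (a = b))"
      using assms that by (simp add: r_def dotp_linear dotp_unit)
    also have "(\<Sum>b<k. v b i * of_bool (a = b)) = (\<Sum>b<k. if b = a then v b i else 0)"
      by (intro sum.cong) auto
    also have "v a i - \<dots> = 0" using that by simp
    finally show ?thesis .
  qed
  show "a < k \<Longrightarrow> dotp n (v a) r = 0" by (rule 1)
  have "dotp n r r = dotp n r (\<lambda>j. of_bool (j = i)) - (\<Sum>a<k. v a i * dotp n r (v a))"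
    by (subst (2) r_def) (simp add: dotp_linear)
  also have "\<dots> = r i"
    using 1 assms(2) by (simp add: dotp_unit dotp_commute[of n r "v _"])
  finally show "dotp n r r = 1 - (\<Sum>a<k. v a i ^ 2)" by (simp add: r_def power2_eq_square)
qed

text \<open>Total squared length of all residuals. Positive for \<open>k < n\<close>, it yields a
  vector off the family; zero for \<open>k = n\<close>, it forces completeness.\<close>

lemma sum_orthonormal_squares:
  assumes "\<And>a. a < k \<Longrightarrow> dotp n (v a) (v a) = 1"
  shows "(\<Sum>i<n. 1 - (\<Sum>a<k. (v a i :: real) ^ 2)) = real n - real k"
proof -
  have "(\<Sum>i<n. \<Sum>a<k. v a i ^ 2) = (\<Sum>a<k. dotp n (v a) (v a))"
    by (subst sum.swap) (simp add: dotp_def power2_eq_square)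
  then show ?thesis using assms by (simp add: sum_subtractf)
qed

lemma quadratic_nonneg_imp_0:
  fixes a c :: real
  assumes "\<And>t. 0 \<le> 2 * t * a + t\<^sup>2 * c" and "c \<ge> 0"
  shows "a = 0"
proof (rule ccontr)
  assume "a \<noteq> 0"
  \<comment> \<open>The minimiser would be \<open>- a / c\<close>; adding 1 to the denominator
    covers \<open>c = 0\<close>.\<close>
  have "0 \<le> 2 * (- a / (c + 1)) * a + (- a / (c + 1))\<^sup>2 * c" by (rule assms)
  also have "\<dots> = - (a\<^sup>2 * (c + 2) / (c + 1)\<^sup>2)"
    using assms(2) by (simp add: divide_simps power2_eq_square) (simp add: algebra_simps)
  also have "\<dots> < 0" using \<open>a \<noteq> 0\<close> assms(2) by (simp add: divide_pos_pos)
  finally show False by simp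
qed

text \<open>One deflation step. The form is maximised on the unit sphere of the complement
  \<open>W\<close> of the eigenvectors found so far. As \<open>M\<close> is symmetric,
  \<open>W\<close> is invariant, so the defect \<open>l x - M x\<close> of the maximiser lies in
  \<open>W\<close> and is an admissible direction of variation.\<close>

lemma rayleigh_maximiser:
  assumes sym: "symm n M" and "k < n"
    and orth: "\<And>a b. a < k \<Longrightarrow> b < k \<Longrightarrow> dotp n (v a) (v b) = of_bool (a = b)"
    and eig: "\<And>a i. a < k \<Longrightarrow> i < n \<Longrightarrow> mulv n M (v a) i = e a * v a i"
  obtains x l where "dotp n x x = 1" "\<And>a. a < k \<Longrightarrow> dotp n (v a) x = 0"
    "\<And>i. i < n \<Longrightarrow> mulv n M x i = l * x i"
    "\<And>y. (\<And>a. a < k \<Longrightarrow> dotp n (v a) y = 0) \<Longrightarrow> dotp n y (mulv n M y) \<le> l * dotp n y y"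
proof -
  define W where "W = {x. \<forall>a<k. dotp n (v a) x = 0}"
  \<comment> \<open>Coordinates from \<open>n\<close> on are pinned to 0: in the product space over
    all naturals the unit sphere of the first \<open>n\<close> coordinates is not compact.\<close>
  define B where "B = PiE UNIV (\<lambda>i. if i < n then {-1..1::real} else {0})"
  define K where "K = B \<inter> {x. dotp n x x = 1} \<inter> (\<Inter>a\<in>{..<k}. {x. dotp n (v a) x = 0})"
  have cont [continuous_intros]: "continuous_on UNIV (\<lambda>x::nat \<Rightarrow> real. x i)" for i
    by (rule continuous_on_product_coordinates)
  have "compactin (product_topology (\<lambda>_. euclidean) UNIV) B"
    unfolding B_def by (subst compactin_PiE) (auto simp: compactin_euclidean_iff)
  then have "compact B" by (simp add: euclidean_product_topology compactin_euclidean_iff)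
  moreover have "closed {x. dotp n x x = 1}"
    unfolding dotp_def by (intro closed_Collect_eq continuous_intros)
  moreover have "closed {x. dotp n (v a) x = 0}" for a
    unfolding dotp_def by (intro closed_Collect_eq continuous_intros)
  ultimately have "compact K" unfolding K_def
    by (intro compact_Int_closed closed_INT) auto
  have normalise: "(\<lambda>i. if i < n then y i / sqrt (dotp n y y) else 0) \<in> K"
    if "y \<in> W" "dotp n y y > 0" for y
  proof -
    let ?z = "\<lambda>i. if i < n then y i / sqrt (dotp n y y) else 0"
    have "dotp n u ?z = dotp n u y / sqrt (dotp n y y)" for u
      by (simp add: dotp_def sum_divide_distrib)
    moreover have "dotp n ?z ?z = dotp n y y / (sqrt (dotp n y y))\<^sup>2"
      by (simp add: dotp_def sum_divide_distrib power2_eq_square)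
    then have 1: "dotp n ?z ?z = 1" using that(2) by simp
    moreover have abs: "\<bar>?z i\<bar> \<le> 1" for i
      using square_le_dotp[of i n ?z] 1 by (cases "i < n") (auto simp: abs_square_le_1)
    have "?z i \<in> (if i < n then {-1..1} else {0})" for i
      using abs[of i] unfolding abs_le_iff by auto
    then have "?z \<in> B" by (simp add: B_def PiE_UNIV_domain Pi_iff)
    ultimately show ?thesis using that by (auto simp: K_def W_def)
  qed
  have "K \<noteq> {}"
  proof -
    define r where "r i = (\<lambda>j. of_bool (j = i) - (\<Sum>a<k. v a i * v a j))" for i
    have "0 < (\<Sum>i<n. 1 - (\<Sum>a<k. v a i ^ 2))"
      using sum_orthonormal_squares[of k n v] orth \<open>k < n\<close> by simp
    then obtain i where "i < n" "0 < 1 - (\<Sum>a<k. v a i ^ 2)"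
      by (meson lessThan_iff not_less sum_nonpos)
    with orthonormal_residual[of k n v i] orth have "r i \<in> W" "dotp n (r i) (r i) > 0"
      by (auto simp: W_def r_def)
    from normalise[OF this] show ?thesis by blast
  qed
  have "continuous_on K (\<lambda>x. dotp n x (mulv n M x))"
    unfolding dotp_def mulv_def
    by (rule continuous_on_subset[of UNIV]) (intro continuous_intros, auto)
  from continuous_attains_sup[OF \<open>compact K\<close> \<open>K \<noteq> {}\<close> this]
  obtain x where x: "x \<in> K" and max: "\<And>y. y \<in> K \<Longrightarrow> dotp n y (mulv n M y) \<le> dotp n x (mulv n M x)"
    by blast
  define l where "l = dotp n x (mulv n M x)"
  have xx: "dotp n x x = 1" and xW: "x \<in> W" using x by (auto simp: K_def W_def)
  have bound: "dotp n y (mulv n M y) \<le> l * dotp n y y" if "y \<in> W" for y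
  proof (cases "dotp n y y = 0")
    case True
    then have "mulv n M y = mulv n M (\<lambda>_. 0)" by (intro mulv_cong) (simp add: dotp_eq_0_iff)
    with True show ?thesis by (simp add: dotp_def mulv_def)
  next
    case False
    then have pos: "dotp n y y > 0" using dotp_nonneg[of n y] by simp
    define s where "s = 1 / sqrt (dotp n y y)"
    have s: "s * s * dotp n y y = 1" using pos by (simp add: s_def divide_simps)
    have "dotp n (\<lambda>i. s * y i) (mulv n M (\<lambda>i. s * y i)) \<le> l"
    proof -
      have *: "mulv n M (\<lambda>i. if i < n then y i / sqrt (dotp n y y) else 0) = mulv n M (\<lambda>i. s * y i)"
        by (rule mulv_cong) (simp add: s_def)
      show ?thesis
        using max[OF normalise[OF that pos]] unfolding * l_def[symmetric]
        by (subst dotp_cong[of n _ "\<lambda>i. if i < n then y i / sqrt (dotp n y y) else 0"]) (auto simp: s_def)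
    qed
    then have "s * s * dotp n y (mulv n M y) \<le> l" by (simp add: mulv_scale dotp_linear)
    then have "(s * s * dotp n y (mulv n M y)) * dotp n y y \<le> l * dotp n y y"
      using pos by simp
    moreover have "(s * s * dotp n y (mulv n M y)) * dotp n y y
        = dotp n y (mulv n M y) * (s * s * dotp n y y)" by (simp only: ac_simps)
    ultimately show ?thesis using s by simp
  qed
  define z where "z = (\<lambda>i. l * x i - mulv n M x i)"
  have zW: "z \<in> W"
  proof -
    have "dotp n (v a) (mulv n M x) = 0" if "a < k" for a
    proof -
      have "dotp n (v a) (mulv n M x) = dotp n (\<lambda>i. e a * v a i) x"
        using that by (subst symm_dotp_mulv[OF sym]) (auto intro!: dotp_cong eig)
      then show ?thesis using xW that by (simp add: dotp_linear W_def)
    qed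
    then show ?thesis using xW by (simp add: W_def z_def dotp_linear)
  qed
  \<comment> \<open>First-order condition: in the bound at \<open>x + t z\<close> the constant term
    vanishes by the choice of \<open>l\<close>, and the coefficient of \<open>t\<close> is
    \<open>2 * dotp n z z\<close>.\<close>
  have "dotp n z z = 0"
  proof (rule quadratic_nonneg_imp_0)
    show "0 \<le> l * dotp n z z - dotp n z (mulv n M z)" using bound[OF zW] by simp
    fix t :: real
    have "(\<lambda>i. x i + t * z i) \<in> W" using xW zW by (simp add: W_def dotp_linear)
    from bound[OF this]
    have "0 \<le> l * dotp n x x - dotp n x (mulv n M x)
        + t * (2 * l * dotp n x z - dotp n x (mulv n M z) - dotp n z (mulv n M x))
        + t\<^sup>2 * (l * dotp n z z - dotp n z (mulv n M z))"
      by (simp add: mulv_add mulv_scale dotp_linear dotp_commute[of n z x]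
          algebra_simps power2_eq_square)
    also have "l * dotp n x x - dotp n x (mulv n M x) = 0" by (simp add: xx l_def)
    also have "dotp n x (mulv n M z) = dotp n z (mulv n M x)"
      by (subst symm_dotp_mulv[OF sym]) (rule dotp_commute)
    also have "2 * l * dotp n x z - dotp n z (mulv n M x) - dotp n z (mulv n M x) = 2 * dotp n z z"
      by (subst (4) z_def) (simp add: dotp_linear dotp_commute[of n z "mulv n M x"])
    finally show "0 \<le> 2 * t * dotp n z z + t\<^sup>2 * (l * dotp n z z - dotp n z (mulv n M z))"
      by simp
  qed
  then have "mulv n M x i = l * x i" if "i < n" for i
    using that by (simp add: dotp_eq_0_iff z_def)
  with xx xW bound show thesis by (intro that[of x l]) (auto simp: W_def)
qed

definition eigensystem :: "nat \<Rightarrow> (nat \<Rightarrow> nat \<Rightarrow> real) \<Rightarrow> (nat \<Rightarrow> nat \<Rightarrow> real) \<Rightarrow> (nat \<Rightarrow> real) \<Rightarrow> bool" where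
  "eigensystem n M v e \<longleftrightarrow>
     (\<forall>a<n. \<forall>b<n. dotp n (v a) (v b) = of_bool (a = b)) \<and>
     (\<forall>i<n. \<forall>j<n. (\<Sum>a<n. v a i * v a j) = of_bool (i = j)) \<and>
     (\<forall>a<n. \<forall>i<n. mulv n M (v a) i = e a * v a i) \<and>
     (\<forall>b<n. \<forall>a\<le>b. e b \<le> e a)"

theorem symmetric_eigensystem:
  assumes sym: "symm n M"
  obtains v e where "eigensystem n M v e"
proof -
  \<comment> \<open>The last clause, maximality of each eigenvalue on the complement of the earlier
    vectors, is what makes \<open>e\<close> decreasing.\<close>
  define P where "P k v e \<longleftrightarrow>
     (\<forall>a<k. \<forall>b<k. dotp n (v a) (v b) = of_bool (a = b)) \<and>
     (\<forall>a<k. \<forall>i<n. mulv n M (v a) i = e a * v a i) \<and>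
     (\<forall>a<k. \<forall>y. (\<forall>b<a. dotp n (v b) y = 0) \<longrightarrow> dotp n y (mulv n M y) \<le> e a * dotp n y y)"
    for k and v :: "nat \<Rightarrow> nat \<Rightarrow> real" and e :: "nat \<Rightarrow> real"
  have "\<exists>v e. P k v e" if "k \<le> n" for k
    using that
  proof (induction k)
    case 0
    then show ?case by (simp add: P_def)
  next
    case (Suc k)
    then obtain v e where P: "P k v e" by auto
    obtain x l where x: "dotp n x x = 1" "\<And>a. a < k \<Longrightarrow> dotp n (v a) x = 0"
      "\<And>i. i < n \<Longrightarrow> mulv n M x i = l * x i"
      "\<And>y. (\<And>a. a < k \<Longrightarrow> dotp n (v a) y = 0) \<Longrightarrow> dotp n y (mulv n M y) \<le> l * dotp n y y"
    proof (rule rayleigh_maximiser[OF sym, of k v e], goal_cases)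
      case (4 x l)
      then show ?case by (intro that[of x l]) auto
    next
      case 1
      then show ?case using Suc.prems by simp
    next
      case (2 a b)
      then show ?case using P by (simp add: P_def)
    next
      case (3 a i)
      then show ?case using P by (simp add: P_def)
    qed
    have "P (Suc k) (v(k := x)) (e(k := l))"
      using P x unfolding P_def by (auto simp: less_Suc_eq dotp_commute[of n x "v _"])
    then show ?case by blast
  qed
  from this[of n] obtain v e where P: "P n v e" by auto
  then have orth: "\<And>a b. a < n \<Longrightarrow> b < n \<Longrightarrow> dotp n (v a) (v b) = of_bool (a = b)"
    by (simp add: P_def)
  have "(\<Sum>a<n. v a i * v a j) = of_bool (i = j)" if "i < n" "j < n" for i j
  proof -
    define r where "r i = (\<lambda>j. of_bool (j = i) - (\<Sum>a<n. v a i * v a j))" for i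
    have rr: "dotp n (r i) (r i) = 1 - (\<Sum>a<n. v a i ^ 2)" if "i < n" for i
      using orthonormal_residual(2)[of n n v i] orth that by (simp add: r_def)
    have "(\<Sum>i<n. dotp n (r i) (r i)) = 0"
      using sum_orthonormal_squares[of n n v] orth by (simp add: rr)
    then have "dotp n (r i) (r i) = 0"
      using that by (subst (asm) sum_nonneg_eq_0_iff) (auto simp: dotp_nonneg)
    then have "r i j = 0" using that by (simp add: dotp_eq_0_iff)
    then show ?thesis by (auto simp: r_def)
  qed
  moreover have "e b \<le> e a" if "a \<le> b" "b < n" for a b
  proof -
    have "dotp n (v b) (mulv n M (v b)) = e b"
      using P that(2) by (subst dotp_cong[of n _ "v b" _ "\<lambda>i. e b * v b i"]) (auto simp: P_def dotp_linear)
    moreover have "\<forall>c<a. dotp n (v c) (v b) = 0" using orth that by simp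
    then have "dotp n (v b) (mulv n M (v b)) \<le> e a * dotp n (v b) (v b)"
      using P that unfolding P_def by (meson le_less_trans)
    ultimately show ?thesis using orth that by simp
  qed
  ultimately show thesis using P by (intro that[of v e]) (auto simp: P_def eigensystem_def)
qed

lemma eigensystemD:
  assumes "eigensystem n M v e"
  shows "a < n \<Longrightarrow> b < n \<Longrightarrow> dotp n (v a) (v b) = of_bool (a = b)"
    and "i < n \<Longrightarrow> j < n \<Longrightarrow> (\<Sum>a<n. v a i * v a j) = of_bool (i = j)"
    and "a < n \<Longrightarrow> i < n \<Longrightarrow> mulv n M (v a) i = e a * v a i"
    and "a \<le> b \<Longrightarrow> b < n \<Longrightarrow> e b \<le> e a"
  using assms by (auto simp: eigensystem_def)

lemma parseval:
  assumes "eigensystem n M v e"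
  shows "dotp n x y = (\<Sum>a<n. dotp n (v a) x * dotp n (v a) y)"
proof -
  have "(\<Sum>a<n. dotp n (v a) x * dotp n (v a) y)
      = (\<Sum>a<n. \<Sum>i<n. \<Sum>j<n. x i * y j * (v a i * v a j))"
    by (simp add: dotp_def sum_product mult_ac)
  also have "\<dots> = (\<Sum>i<n. \<Sum>j<n. x i * y j * (\<Sum>a<n. v a i * v a j))"
    by (subst sum.swap, rule sum.cong[OF refl], subst sum.swap) (simp add: sum_distrib_left)
  also have "\<dots> = (\<Sum>i<n. \<Sum>j<n. if j = i then x i * y j else 0)"
    by (intro sum.cong refl) (auto simp: eigensystemD(2)[OF assms])
  finally show ?thesis by (simp add: dotp_def)
qed

lemma quadratic_form_diagonal:
  assumes "symm n M" and es: "eigensystem n M v e"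
  shows "dotp n x (mulv n M x) = (\<Sum>a<n. e a * dotp n (v a) x ^ 2)"
proof -
  have "dotp n (v a) (mulv n M x) = e a * dotp n (v a) x" if "a < n" for a
  proof -
    have "dotp n (v a) (mulv n M x) = dotp n (\<lambda>i. e a * v a i) x"
      using that by (subst symm_dotp_mulv[OF assms(1)]) (auto intro!: dotp_cong eigensystemD(3)[OF es])
    then show ?thesis by (simp add: dotp_linear)
  qed
  then show ?thesis by (subst parseval[OF es]) (simp add: power2_eq_square mult_ac)
qed

lemma quadratic_form_le:
  assumes "symm n M" "eigensystem n M v e" and "\<And>b. b < a \<Longrightarrow> dotp n (v b) x = 0"
  shows "dotp n x (mulv n M x) \<le> e a * dotp n x x"
proof -
  have "(\<Sum>b<n. e b * dotp n (v b) x ^ 2) \<le> (\<Sum>b<n. e a * dotp n (v b) x ^ 2)"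
  proof (intro sum_mono)
    fix b assume "b \<in> {..<n}"
    then show "e b * dotp n (v b) x ^ 2 \<le> e a * dotp n (v b) x ^ 2"
      using assms(3)[of b] eigensystemD(4)[OF assms(2), of a b]
      by (cases "b < a") (auto intro: mult_right_mono)
  qed
  then show ?thesis
    by (simp add: quadratic_form_diagonal[OF assms(1,2)] parseval[OF assms(2), of x x]
        power2_eq_square sum_distrib_left)
qed

lemma abs_quadratic_form_le:
  assumes "symm n M" "eigensystem n M v e" and "\<And>a. a < n \<Longrightarrow> \<bar>e a\<bar> \<le> l"
  shows "\<bar>dotp n x (mulv n M x)\<bar> \<le> l * dotp n x x"
proof -
  have "\<bar>\<Sum>b<n. e b * dotp n (v b) x ^ 2\<bar> \<le> (\<Sum>b<n. l * dotp n (v b) x ^ 2)"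
    by (rule order_trans[OF sum_abs], intro sum_mono)
      (auto simp: abs_mult intro!: mult_right_mono assms(3))
  then show ?thesis
    by (simp add: quadratic_form_diagonal[OF assms(1,2)] parseval[OF assms(2), of x x]
        power2_eq_square sum_distrib_left)
qed

section \<open>The second largest eigenvalue and its variational bounds\<close>

lemma proots_linear_factors: "proots (\<Prod>a\<leftarrow>xs. [:- a, 1:]) = mset (xs :: real list)"
proof (induction xs)
  case (Cons a xs)
  have "(\<Prod>a\<leftarrow>xs. [:- a, 1:]) \<noteq> 0" by (auto simp: prod_list_zero_iff)
  then have "proots ([:- a, 1:] * (\<Prod>a\<leftarrow>xs. [:- a, 1:])) = {#a#} + proots (\<Prod>a\<leftarrow>xs. [:- a, 1:])"
    by (subst proots_mult) auto
  with Cons show ?case by simp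
qed simp

text \<open>Diagonalisation makes the characteristic polynomial split with root list
  \<open>e\<close>. Since \<open>e\<close> decreases, sorting reverses the list, and the
  \<open>rev\<close> in the definition restores it.\<close>

lemma second_eigenvalue_eigensystem:
  assumes es: "eigensystem n M v e" and sym: "symm n M" and "2 \<le> n"
  shows "second_eigenvalue (mat n n (\<lambda>(i, j). M i j)) = e 1"
proof -
  define A where "A = mat n n (\<lambda>(i, j). M i j)"
  define P where "P = mat n n (\<lambda>(i, a). v a i)"
  define Q where "Q = mat n n (\<lambda>(a, i). v a i)"
  define D where "D = mat n n (\<lambda>(a, b). if a = b then e a else 0)"
  have carrier: "A \<in> carrier_mat n n" "P \<in> carrier_mat n n" "Q \<in> carrier_mat n n" "D \<in> carrier_mat n n"
    by (simp_all add: A_def P_def Q_def D_def)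
  have PQ: "P * Q = 1\<^sub>m n"
    by (rule eq_matI)
      (auto simp: P_def Q_def scalar_prod_def eigensystemD(2)[OF es] simp flip: lessThan_atLeast0)
  have QP: "Q * P = 1\<^sub>m n"
    by (rule eq_matI)
      (auto simp: P_def Q_def scalar_prod_def eigensystemD(1)[OF es, unfolded dotp_def]
        simp flip: lessThan_atLeast0)
  have "A * P = P * D"
  proof (rule eq_matI)
    fix i a assume "i < dim_row (P * D)" "a < dim_col (P * D)"
    then have ia: "i < n" "a < n" by (auto simp: P_def D_def)
    then have "(A * P) $$ (i, a) = mulv n M (v a) i"
      by (simp add: A_def P_def scalar_prod_def mulv_def flip: lessThan_atLeast0)
    also have "\<dots> = (\<Sum>b<n. if b = a then v b i * e b else 0)"
      using ia by (simp add: eigensystemD(3)[OF es])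
    also have "\<dots> = (\<Sum>b<n. v b i * (if b = a then e b else 0))"
      by (intro sum.cong) auto
    also have "\<dots> = (P * D) $$ (i, a)"
      using ia by (simp add: D_def P_def scalar_prod_def flip: lessThan_atLeast0)
    finally show "(A * P) $$ (i, a) = (P * D) $$ (i, a)" .
  qed (auto simp: A_def P_def D_def)
  then have "P * D * Q = A * (P * Q)"
    using carrier by (metis assoc_mult_mat)
  then have "A = P * D * Q" using PQ carrier by simp
  then have "similar_mat_wit A D P Q"
    using PQ QP carrier by (intro similar_mat_witI) auto
  then have "char_poly A = char_poly D"
    by (intro char_poly_similar) (auto simp: similar_mat_def)
  also have "\<dots> = (\<Prod>a\<leftarrow>diag_mat D. [:- a, 1:])"
    by (rule char_poly_upper_triangular[OF carrier(4)]) (auto simp: D_def)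
  also have "diag_mat D = map e [0..<n]" by (auto simp: diag_mat_def D_def)
  finally have "proots (char_poly A) = proots (\<Prod>a\<leftarrow>map e [0..<n]. [:- a, 1:])" by simp
  also have "\<dots> = mset (map e [0..<n])"
    by (rule proots_linear_factors)
  finally have "sorted_list_of_multiset (proots (char_poly A)) = sort (map e [0..<n])"
    by (simp only: sorted_list_of_multiset_mset)
  also have "\<dots> = rev (map e [0..<n])"
  proof (rule properties_for_sort)
    show "sorted (rev (map e [0..<n]))"
      unfolding sorted_wrt_rev
      by (auto simp: sorted_wrt_iff_nth_less intro!: eigensystemD(4)[OF es])
  qed simp
  finally show ?thesis
    using assms(3) by (simp add: second_eigenvalue_def flip: A_def)
qed

text \<open>The span of two top eigenvectors has dimension 2, so it meets every hyperplane in a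
  nonzero vector, and on it the form is at least \<open>e 1\<close>. The hyperplane of interest is
  orthogonal to the all-ones vector.\<close>

lemma second_eigenvalue_upper_witness:
  assumes "symm n M" "2 \<le> n"
  obtains x where "dotp n w x = 0" "dotp n x x > 0"
    "second_eigenvalue (mat n n (\<lambda>(i, j). M i j)) * dotp n x x \<le> dotp n x (mulv n M x)"
proof -
  obtain v e where es: "eigensystem n M v e" using symmetric_eigensystem[OF assms(1)] .
  define c d where "c = dotp n w (v 0)" and "d = dotp n w (v 1)"
  \<comment> \<open>The pair \<open>(d, - c)\<close> is orthogonal to \<open>(c, d)\<close>; if both
    vanish, any nonzero pair serves. The lower bound on the second eigenvalue makes the same
    choice.\<close>
  define a b where "a = (if c = 0 \<and> d = 0 then 1 else d)" and "b = (if c = 0 \<and> d = 0 then 0 else - c)"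
  have ab: "a * c + b * d = 0" "a\<^sup>2 + b\<^sup>2 > 0"
    by (auto simp: a_def b_def sum_power2_gt_zero_iff)
  define x where "x = (\<lambda>i. a * v 0 i + b * v 1 i)"
  have "dotp n w x = 0" using ab by (simp add: x_def dotp_linear c_def d_def)
  moreover have coord: "dotp n (v j) x = a * of_bool (j = 0) + b * of_bool (j = 1)" if "j < n" for j
    using that assms(2) by (simp add: x_def dotp_linear eigensystemD(1)[OF es])
  have sum2: "(\<Sum>j<n. f j * (dotp n (v j) x)\<^sup>2) = f 0 * a\<^sup>2 + f 1 * b\<^sup>2" for f
  proof -
    have "(\<Sum>j<n. f j * (dotp n (v j) x)\<^sup>2) = (\<Sum>j\<in>{0, 1}. f j * (dotp n (v j) x)\<^sup>2)"
      by (rule sum.mono_neutral_right) (use assms(2) in \<open>auto simp: coord\<close>)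
    then show ?thesis using assms(2) by (simp add: coord)
  qed
  have xx: "dotp n x x = a\<^sup>2 + b\<^sup>2"
    using sum2[of "\<lambda>_. 1"] by (simp add: parseval[OF es, of x x] power2_eq_square)
  moreover have "e 1 * dotp n x x \<le> dotp n x (mulv n M x)"
    unfolding xx quadratic_form_diagonal[OF assms(1) es] sum2
    using eigensystemD(4)[OF es, of 0 1] assms(2) by (simp add: distrib_left mult_right_mono)
  ultimately show thesis
    using ab second_eigenvalue_eigensystem[OF es assms] by (intro that[of x]) auto
qed

text \<open>Dual dimension count: the plane of \<open>f\<close> and \<open>g\<close> meets the
  complement of the top eigenvector, where the form is at most \<open>e 1\<close>.\<close>

lemma second_eigenvalue_ge:
  assumes "symm n M" "2 \<le> n"
    and bound: "\<And>a b x. x = (\<lambda>i. a * f i + b * g i) \<Longrightarrow> t * dotp n x x \<le> dotp n x (mulv n M x)"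
    and indep: "\<And>a b x. x = (\<lambda>i. a * f i + b * g i) \<Longrightarrow> dotp n x x = 0 \<Longrightarrow> a = 0 \<and> b = 0"
  shows "t \<le> second_eigenvalue (mat n n (\<lambda>(i, j). M i j))"
proof -
  obtain v e where es: "eigensystem n M v e" using symmetric_eigensystem[OF assms(1)] .
  define c d where "c = dotp n (v 0) f" and "d = dotp n (v 0) g"
  define a b where "a = (if c = 0 \<and> d = 0 then 1 else d)" and "b = (if c = 0 \<and> d = 0 then 0 else - c)"
  define x where "x = (\<lambda>i. a * f i + b * g i)"
  have "a \<noteq> 0 \<or> b \<noteq> 0" by (auto simp: a_def b_def)
  then have pos: "dotp n x x > 0" using indep[OF x_def] dotp_nonneg[of n x] by force
  have "dotp n (v 0) x = a * c + b * d" by (simp add: x_def dotp_linear c_def d_def)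
  then have "dotp n (v 0) x = 0" by (auto simp: a_def b_def)
  then have "dotp n x (mulv n M x) \<le> e 1 * dotp n x x"
    by (intro quadratic_form_le[OF assms(1) es]) simp
  with bound[OF x_def] have "t * dotp n x x \<le> e 1 * dotp n x x" by linarith
  with pos show ?thesis by (simp add: second_eigenvalue_eigensystem[OF es assms(1,2)])
qed

section \<open>Traces of matrix powers\<close>

fun mpow :: "nat \<Rightarrow> (nat \<Rightarrow> nat \<Rightarrow> real) \<Rightarrow> nat \<Rightarrow> nat \<Rightarrow> nat \<Rightarrow> real" where
  "mpow n M 0 i j = of_bool (i = j)"
| "mpow n M (Suc l) i j = (\<Sum>k<n. mpow n M l i k * M k j)"

definition trace_pow :: "nat \<Rightarrow> (nat \<Rightarrow> nat \<Rightarrow> real) \<Rightarrow> nat \<Rightarrow> real" where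
  "trace_pow n M l = (\<Sum>i<n. mpow n M l i i)"

lemma mpow_eigensystem:
  assumes sym: "symm n M" and es: "eigensystem n M v e"
  shows "i < n \<Longrightarrow> j < n \<Longrightarrow> mpow n M l i j = (\<Sum>a<n. e a ^ l * v a i * v a j)"
proof (induction l arbitrary: j)
  case 0
  then show ?case by (simp add: eigensystemD(2)[OF es])
next
  case (Suc l)
  have "mpow n M (Suc l) i j = (\<Sum>k<n. \<Sum>a<n. e a ^ l * v a i * (M j k * v a k))"
    using Suc sym by (auto simp: symm_def sum_distrib_left mult_ac intro!: sum.cong)
  also have "\<dots> = (\<Sum>a<n. e a ^ l * v a i * mulv n M (v a) j)"
    by (subst sum.swap) (simp add: mulv_def sum_distrib_left)
  finally show ?case using Suc.prems by (simp add: eigensystemD(3)[OF es] mult_ac)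
qed

lemma trace_pow_eigensystem:
  assumes "symm n M" and es: "eigensystem n M v e"
  shows "trace_pow n M l = (\<Sum>a<n. e a ^ l)"
proof -
  have "trace_pow n M l = (\<Sum>i<n. \<Sum>a<n. e a ^ l * (v a i * v a i))"
    by (simp add: trace_pow_def mpow_eigensystem[OF assms] mult_ac)
  also have "\<dots> = (\<Sum>a<n. e a ^ l * dotp n (v a) (v a))"
    by (subst sum.swap) (simp add: dotp_def sum_distrib_left)
  finally show ?thesis by (simp add: eigensystemD(1)[OF es])
qed

text \<open>With an even exponent no eigenvalue contributes negatively, so the top one alone is
  dominated by the trace.\<close>

lemma trace_pow_ge:
  assumes "symm n M" "even l" "0 \<le> t" "dotp n x x > 0" "t * dotp n x x \<le> dotp n x (mulv n M x)"
  shows "t ^ l \<le> trace_pow n M l"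
proof -
  obtain v e where es: "eigensystem n M v e" using symmetric_eigensystem[OF assms(1)] .
  have "n > 0" using assms(4) by (cases n) (auto simp: dotp_def)
  have "dotp n x (mulv n M x) \<le> e 0 * dotp n x x"
    by (intro quadratic_form_le[OF assms(1) es]) simp
  with assms(4,5) have "t \<le> e 0" by (meson mult_le_cancel_right_pos order_trans)
  then have "t ^ l \<le> e 0 ^ l" using assms by (intro power_mono)
  also have "\<dots> \<le> (\<Sum>a<n. e a ^ l)"
    using \<open>n > 0\<close> assms(2) by (intro member_le_sum) (auto simp: zero_le_even_power)
  finally show ?thesis by (simp add: trace_pow_eigensystem[OF assms(1) es])
qed

subsection \<open>Lattice points approximating the unit sphere\<close>

text \<open>Integer points in the ball of radius \<open>4 * sqrt n\<close>: divided by that radius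
  they form a net of the unit sphere. The box makes finiteness visible.\<close>

definition lattice_net :: "nat \<Rightarrow> (nat \<Rightarrow> int) set" where
  "lattice_net n = {z \<in> {..<n} \<rightarrow>\<^sub>E {- int (16 * n)..int (16 * n)}. (\<Sum>i<n. (z i)\<^sup>2) \<le> int (16 * n)}"

lemma finite_lattice_net: "finite (lattice_net n)"
  unfolding lattice_net_def
  by (rule finite_subset[of _ "{..<n} \<rightarrow>\<^sub>E {- int (16 * n)..int (16 * n)}"]) (auto intro: finite_PiE)

lemma abs_le_square_int: "\<bar>a\<bar> \<le> a\<^sup>2" for a :: int
proof (cases "a = 0")
  case False
  then have "\<bar>a\<bar> * 1 \<le> \<bar>a\<bar> * \<bar>a\<bar>" by (intro mult_left_mono) auto
  then show ?thesis by (simp add: power2_eq_square)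
qed simp

lemma sum_half_powers_le: "(\<Sum>j\<in>{- int N..int N}. (1 / 2 :: real) ^ nat \<bar>j\<bar>) \<le> 3"
proof -
  \<comment> \<open>The sum equals \<open>3 - 2 / 2 ^ N\<close>; the bare bound 3 would not survive
    the induction.\<close>
  have "(\<Sum>j\<in>{- int N..int N}. (1 / 2 :: real) ^ nat \<bar>j\<bar>) \<le> 3 - 2 / 2 ^ N"
  proof (induction N)
    case (Suc N)
    have "{- int (Suc N)..int (Suc N)} = insert (- int (Suc N)) (insert (int (Suc N)) {- int N..int N})"
      by auto
    then have "(\<Sum>j\<in>{- int (Suc N)..int (Suc N)}. (1 / 2 :: real) ^ nat \<bar>j\<bar>)
        = 2 * (1 / 2) ^ Suc N + (\<Sum>j\<in>{- int N..int N}. (1 / 2 :: real) ^ nat \<bar>j\<bar>)"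
      by (simp add: nat_add_distrib)
    with Suc show ?case by (simp add: field_simps)
  qed simp
  also have "\<dots> \<le> 3" by simp
  finally show ?thesis .
qed

text \<open>Counting by exponential weights: a point weighs the product of
  \<open>2 ^ (- |z i|)\<close>. On the net \<open>|z i| <= (z i) ^ 2\<close> makes this at least
  \<open>2 ^ (- 16 n)\<close>, while the whole box weighs at most \<open>3 ^ n\<close>.\<close>

lemma card_lattice_net: "real (card (lattice_net n)) \<le> (3 * 2 ^ 16) ^ n"
proof -
  let ?B = "{- int (16 * n)..int (16 * n)}"
  have "real (card (lattice_net n)) * (1 / 2) ^ (16 * n) = (\<Sum>z\<in>lattice_net n. (1 / 2 :: real) ^ (16 * n))"
    by simp
  also have "\<dots> \<le> (\<Sum>z\<in>lattice_net n. \<Prod>i<n. (1 / 2) ^ nat \<bar>z i\<bar>)"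
  proof (intro sum_mono)
    fix z assume "z \<in> lattice_net n"
    then have "(\<Sum>i<n. (z i)\<^sup>2) \<le> int (16 * n)" by (simp add: lattice_net_def)
    then have "(\<Sum>i<n. \<bar>z i\<bar>) \<le> int (16 * n)"
      by (rule order_trans[rotated]) (intro sum_mono abs_le_square_int)
    then have "int (\<Sum>i<n. nat \<bar>z i\<bar>) \<le> int (16 * n)" by simp
    then have "(\<Sum>i<n. nat \<bar>z i\<bar>) \<le> 16 * n" by (simp only: of_nat_le_iff)
    then show "(1 / 2 :: real) ^ (16 * n) \<le> (\<Prod>i<n. (1 / 2) ^ nat \<bar>z i\<bar>)"
      unfolding power_sum[symmetric] by (intro power_decreasing) auto
  qed
  also have "\<dots> \<le> (\<Sum>z\<in>{..<n} \<rightarrow>\<^sub>E ?B. \<Prod>i<n. (1 / 2) ^ nat \<bar>z i\<bar>)"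
  proof (rule sum_mono2)
    show "finite ({..<n} \<rightarrow>\<^sub>E ?B)" by (intro finite_PiE) auto
    show "lattice_net n \<subseteq> {..<n} \<rightarrow>\<^sub>E ?B" by (auto simp only: lattice_net_def)
    show "0 \<le> (\<Prod>i<n. (1 / 2 :: real) ^ nat \<bar>z i\<bar>)" for z by (intro prod_nonneg) simp
  qed
  also have "\<dots> = (\<Prod>i<n. \<Sum>j\<in>?B. (1 / 2) ^ nat \<bar>j\<bar>)"
    by (rule prod_sum_PiE[symmetric]) auto
  also have "\<dots> \<le> (\<Prod>i<n. 3)"
    by (intro prod_mono conjI sum_half_powers_le sum_nonneg) auto
  finally have "real (card (lattice_net n)) * (1 / 2) ^ (16 * n) \<le> 3 ^ n" by simp
  then have "real (card (lattice_net n)) * (1 / 2) ^ (16 * n) * 2 ^ (16 * n) \<le> 3 ^ n * 2 ^ (16 * n)"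
    by (rule mult_right_mono) simp
  moreover have "(1 / 2 :: real) ^ (16 * n) * 2 ^ (16 * n) = 1" by (simp flip: power_mult_distrib)
  ultimately show ?thesis by (simp only: mult.assoc mult_1_right power_mult_distrib power_mult)
qed

text \<open>Rounding \<open>4 \<sqrt>n x\<close> towards zero moves \<open>x\<close> by at most \<open>1/4\<close> in norm.\<close>

lemma lattice_net_approx:
  assumes "dotp n x x = 1"
  obtains z where "z \<in> lattice_net n"
    "dotp n (\<lambda>i. z i / (4 * sqrt n) - x i) (\<lambda>i. z i / (4 * sqrt n) - x i) \<le> 1 / 16"
proof -
  have "n > 0" using assms by (cases n) (auto simp: dotp_def)
  define s where "s = 4 * sqrt (real n)"
  have s: "s > 0" "s * s = 16 * real n" using \<open>n > 0\<close> by (auto simp: s_def)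
  \<comment> \<open>Rounding towards zero never increases a coordinate in absolute value, so
    \<open>z\<close> stays in the ball.\<close>
  define z where "z = (\<lambda>i\<in>{..<n}. if x i \<ge> 0 then \<lfloor>s * x i\<rfloor> else \<lceil>s * x i\<rceil>)"
  have z: "\<bar>real_of_int (z i)\<bar> \<le> \<bar>s * x i\<bar>" "\<bar>real_of_int (z i) - s * x i\<bar> \<le> 1" if "i < n" for i
  proof -
    have "\<bar>real_of_int (z i)\<bar> \<le> \<bar>s * x i\<bar> \<and> \<bar>real_of_int (z i) - s * x i\<bar> \<le> 1"
    proof (cases "x i \<ge> 0")
      case True
      then have "0 \<le> s * x i" using s by simp
      moreover from this have "0 \<le> real_of_int \<lfloor>s * x i\<rfloor>" by simp
      ultimately show ?thesis
        using True that floor_correct[of "s * x i"] by (simp add: z_def) linarith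
    next
      case False
      then have "s * x i \<le> 0" using s by (simp add: mult_le_0_iff)
      moreover from this have "real_of_int \<lceil>s * x i\<rceil> \<le> 0" by (simp add: ceiling_le_iff)
      ultimately show ?thesis
        using False that ceiling_correct[of "s * x i"] by (simp add: z_def)
    qed
    then show "\<bar>real_of_int (z i)\<bar> \<le> \<bar>s * x i\<bar>" "\<bar>real_of_int (z i) - s * x i\<bar> \<le> 1" by auto
  qed
  have "(\<Sum>i<n. real_of_int ((z i)\<^sup>2)) \<le> (\<Sum>i<n. (s * x i)\<^sup>2)"
  proof (intro sum_mono)
    fix i assume "i \<in> {..<n}"
    then have "\<bar>real_of_int (z i)\<bar>\<^sup>2 \<le> \<bar>s * x i\<bar>\<^sup>2" using z(1)[of i] by (intro power_mono) auto
    then show "real_of_int ((z i)\<^sup>2) \<le> (s * x i)\<^sup>2" by simp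
  qed
  also have "\<dots> = s * s * dotp n x x"
    by (simp add: dotp_def sum_distrib_left power2_eq_square mult_ac)
  also have "\<dots> = real_of_int (int (16 * n))" using s assms by simp
  finally have sum: "(\<Sum>i<n. (z i)\<^sup>2) \<le> int (16 * n)"
    unfolding of_int_sum[symmetric] of_int_le_iff .
  have "z i \<in> {- int (16 * n)..int (16 * n)}" if "i < n" for i
    using member_le_sum[of i "{..<n}" "\<lambda>i. (z i)\<^sup>2"] sum that abs_le_square_int[of "z i"]
    by (auto simp: abs_le_iff)
  moreover have "z \<in> extensional {..<n}" by (simp add: z_def)
  ultimately have "z \<in> lattice_net n" using sum by (simp add: lattice_net_def PiE_iff)
  moreover have "dotp n (\<lambda>i. z i / s - x i) (\<lambda>i. z i / s - x i) \<le> (\<Sum>i<n. 1 / (s * s))"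
    unfolding dotp_def
  proof (intro sum_mono)
    fix i assume "i \<in> {..<n}"
    then have "\<bar>real_of_int (z i) - s * x i\<bar>\<^sup>2 \<le> 1\<^sup>2" using z(2)[of i] by (intro power_mono) auto
    then have "(real_of_int (z i) - s * x i)\<^sup>2 \<le> 1" by simp
    moreover have "z i / s - x i = (real_of_int (z i) - s * x i) / s"
      using s(1) by (simp add: diff_divide_distrib)
    ultimately show "(z i / s - x i) * (z i / s - x i) \<le> 1 / (s * s)"
      using s(1) by (simp add: divide_right_mono power2_eq_square)
  qed
  then have "dotp n (\<lambda>i. z i / s - x i) (\<lambda>i. z i / s - x i) \<le> 1 / 16"
    using s \<open>n > 0\<close> by simp
  then show thesis by (rule that[OF \<open>z \<in> lattice_net n\<close>, unfolded s_def[symmetric]])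
qed

text \<open>At a net point within \<open>1/4\<close> of a unit eigenvector for the eigenvalue of
  largest modulus, the form still has at least a quarter of that modulus. The maximum over the net
  is replaced by a sum so that expectations can be taken termwise.\<close>

lemma trace_pow_le_net:
  assumes sym: "symm n M" and "even l" "n > 0"
  shows "trace_pow n M l \<le>
    real n * (\<Sum>z\<in>lattice_net n. (dotp n (\<lambda>i. z i) (mulv n M (\<lambda>i. z i)) / (4 * real n)) ^ l)"
proof -
  obtain v e where es: "eigensystem n M v e" using symmetric_eigensystem[OF sym] .
  have "Max ((\<lambda>a. \<bar>e a\<bar>) ` {..<n}) \<in> (\<lambda>a. \<bar>e a\<bar>) ` {..<n}"
    using \<open>n > 0\<close> by (intro Max_in) auto
  then obtain a where "a < n" and "\<bar>e a\<bar> = Max ((\<lambda>a. \<bar>e a\<bar>) ` {..<n})" by auto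
  then have max: "\<bar>e b\<bar> \<le> \<bar>e a\<bar>" if "b < n" for b using that by simp
  have norm: "dotp n (v a) (v a) = 1" using eigensystemD(1)[OF es] \<open>a < n\<close> by simp
  obtain z where z: "z \<in> lattice_net n"
    and close: "dotp n (\<lambda>i. z i / (4 * sqrt n) - v a i) (\<lambda>i. z i / (4 * sqrt n) - v a i) \<le> 1 / 16"
    using lattice_net_approx[OF norm] by blast
  define d where "d = (\<lambda>i. z i / (4 * sqrt n) - v a i)"
  define x where "x = (\<lambda>i. v a i + d i)"
  have x: "x = (\<lambda>i. 1 / (4 * sqrt n) * z i)" by (simp add: x_def d_def)
  have dd: "dotp n d d \<le> 1 / 16" using close by (simp add: d_def)
  have Mv: "dotp n y (mulv n M (v a)) = e a * dotp n y (v a)" for y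
  proof -
    have "dotp n y (mulv n M (v a)) = dotp n y (\<lambda>i. e a * v a i)"
      using \<open>a < n\<close> by (intro dotp_cong) (auto simp: eigensystemD(3)[OF es])
    then show ?thesis by (simp add: dotp_linear)
  qed
  have "dotp n (v a) (mulv n M d) = e a * dotp n d (v a)"
    by (subst symm_dotp_mulv[OF sym]) (simp add: dotp_commute[of n _ d] Mv)
  then have q: "dotp n x (mulv n M x) = e a * (1 + 2 * dotp n d (v a)) + dotp n d (mulv n M d)"
    by (simp add: x_def mulv_add dotp_linear Mv norm algebra_simps)
  \<comment> \<open>Cauchy-Schwarz for the unit vector \<open>v a\<close> and the error
    \<open>d\<close> of length at most \<open>1/4\<close>.\<close>
  have "0 \<le> dotp n (\<lambda>i. v a i + 4 * d i) (\<lambda>i. v a i + 4 * d i)" by (rule dotp_nonneg)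
  also have "\<dots> = 1 + 8 * dotp n d (v a) + 16 * dotp n d d"
    by (simp add: dotp_linear norm dotp_commute[of n "v a" d])
  finally have dv: "1 / 2 \<le> 1 + 2 * dotp n d (v a)" using dd by simp
  have "\<bar>dotp n d (mulv n M d)\<bar> \<le> \<bar>e a\<bar> * dotp n d d"
    by (rule abs_quadratic_form_le[OF sym es max])
  also have "\<dots> \<le> \<bar>e a\<bar> * (1 / 16)" using dd by (intro mult_left_mono) auto
  finally have 1: "\<bar>dotp n d (mulv n M d)\<bar> \<le> \<bar>e a\<bar> * (1 / 16)" .
  have "\<bar>e a\<bar> * (1 / 2) \<le> \<bar>e a * (1 + 2 * dotp n d (v a))\<bar>"
    unfolding abs_mult using dv by (intro mult_left_mono) auto
  with 1 q have "\<bar>e a\<bar> \<le> 4 * \<bar>dotp n x (mulv n M x)\<bar>" by linarith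
  also have "dotp n x (mulv n M x) = dotp n (\<lambda>i. z i) (mulv n M (\<lambda>i. z i)) / (16 * real n)"
    unfolding x mulv_scale dotp_linear using \<open>n > 0\<close> by (simp add: field_simps)
  finally have "\<bar>e a\<bar> \<le> \<bar>dotp n (\<lambda>i. z i) (mulv n M (\<lambda>i. z i)) / (4 * real n)\<bar>" by simp
  then have "\<bar>e a\<bar> ^ l \<le> (dotp n (\<lambda>i. z i) (mulv n M (\<lambda>i. z i)) / (4 * real n)) ^ l"
    using power_mono[of "\<bar>e a\<bar>" _ l] assms(2) by (metis abs_ge_zero power_even_abs)
  also have "\<dots> \<le> (\<Sum>z\<in>lattice_net n. (dotp n (\<lambda>i. z i) (mulv n M (\<lambda>i. z i)) / (4 * real n)) ^ l)"
    using z assms(2) finite_lattice_net by (intro member_le_sum) (auto simp: zero_le_even_power)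
  finally have *: "\<bar>e a\<bar> ^ l \<le> \<dots>" .
  have "trace_pow n M l = (\<Sum>b<n. \<bar>e b\<bar> ^ l)"
    using assms(2) by (simp add: trace_pow_eigensystem[OF sym es] power_even_abs)
  also have "\<dots> \<le> (\<Sum>b<n. \<bar>e a\<bar> ^ l)" by (intro sum_mono power_mono max) auto
  also have "\<dots> = n * \<bar>e a\<bar> ^ l" by simp
  also have "\<dots> \<le> n * (\<Sum>z\<in>lattice_net n. (dotp n (\<lambda>i. z i) (mulv n M (\<lambda>i. z i)) / (4 * real n)) ^ l)"
    using * by (intro mult_left_mono) auto
  finally show ?thesis .
qed

subsection \<open>Closed walks and expected traces\<close>

definition closed_walks :: "nat \<Rightarrow> nat \<Rightarrow> (nat \<Rightarrow> nat) set" where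
  "closed_walks n l = {u \<in> {..l} \<rightarrow>\<^sub>E {..<n}. u l = u 0}"

lemma finite_closed_walks: "finite (closed_walks n l)"
  unfolding closed_walks_def by (rule finite_subset[of _ "{..l} \<rightarrow>\<^sub>E {..<n}"]) (auto intro: finite_PiE)

lemma mpow_walks:
  assumes "i < n" "j < n"
  shows "mpow n M l i j = (\<Sum>u\<in>{..l} \<rightarrow>\<^sub>E {..<n}.
    of_bool (u 0 = i) * of_bool (u l = j) * (\<Prod>t<l. M (u t) (u (Suc t))))"
  using assms(2)
proof (induction l arbitrary: j)
  case 0
  have eq: "{..0::nat} \<rightarrow>\<^sub>E {..<n} = (\<lambda>a. (\<lambda>x. undefined)(0 := a)) ` {..<n}"
    using PiE_insert_eq[of "0::nat" "{}" "\<lambda>_. {..<n}"] by (auto simp: image_iff)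
  have "(\<Sum>u\<in>{..0::nat} \<rightarrow>\<^sub>E {..<n}. of_bool (u 0 = i) * of_bool (u 0 = j))
      = (\<Sum>a<n. of_bool (a = i) * of_bool (a = j) :: real)"
    unfolding eq by (subst sum.reindex) (auto simp: inj_on_def dest: fun_upd_eqD)
  also have "\<dots> = (\<Sum>a<n. if a = i then of_bool (a = j) else 0)" by (intro sum.cong) auto
  finally show ?case using assms(1) by simp
next
  case (Suc l)
  let ?S = "{..l} \<rightarrow>\<^sub>E {..<n}"
  let ?F = "\<lambda>u. of_bool (u 0 = i) * of_bool (u (Suc l) = j) * (\<Prod>t<Suc l. M (u t) (u (Suc t)))"
  have "{..Suc l} \<rightarrow>\<^sub>E {..<n} = (\<lambda>(y, g). g(Suc l := y)) ` ({..<n} \<times> ?S)"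
    using PiE_insert_eq[of "Suc l" "{..l}" "\<lambda>_. {..<n}"] by (simp add: atMost_Suc)
  then have "(\<Sum>u\<in>{..Suc l} \<rightarrow>\<^sub>E {..<n}. ?F u) = (\<Sum>(y, g)\<in>{..<n} \<times> ?S. ?F (g(Suc l := y)))"
    by (simp only:, subst sum.reindex[OF inj_combinator]) (simp_all add: case_prod_unfold)
  also have "\<dots> = (\<Sum>y<n. \<Sum>g\<in>?S. ?F (g(Suc l := y)))"
    by (rule sum.cartesian_product[symmetric])
  also have "\<dots> = (\<Sum>g\<in>?S. \<Sum>y<n. ?F (g(Suc l := y)))" by (rule sum.swap)
  also have "\<dots> = (\<Sum>g\<in>?S. of_bool (g 0 = i) * (\<Prod>t<l. M (g t) (g (Suc t))) * M (g l) j)"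
  proof (intro sum.cong refl)
    fix g assume "g \<in> ?S"
    have "?F (g(Suc l := y)) = (if y = j then of_bool (g 0 = i) * (\<Prod>t<l. M (g t) (g (Suc t))) * M (g l) j else 0)" for y
      by (auto simp: prod.lessThan_Suc intro!: prod.cong)
    then show "(\<Sum>y<n. ?F (g(Suc l := y))) = of_bool (g 0 = i) * (\<Prod>t<l. M (g t) (g (Suc t))) * M (g l) j"
      using Suc.prems by simp
  qed
  also have "\<dots> = (\<Sum>g\<in>?S. \<Sum>k<n. if k = g l then of_bool (g 0 = i) * (\<Prod>t<l. M (g t) (g (Suc t))) * M k j else 0)"
    by (intro sum.cong refl) (auto simp: PiE_iff)
  also have "\<dots> = (\<Sum>k<n. (\<Sum>g\<in>?S. of_bool (g 0 = i) * of_bool (g l = k) * (\<Prod>t<l. M (g t) (g (Suc t)))) * M k j)"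
    by (subst sum.swap) (auto simp: sum_distrib_right intro!: sum.cong)
  also have "\<dots> = mpow n M (Suc l) i j" using Suc.IH by simp
  finally show ?case by simp
qed

lemma trace_pow_walks:
  "trace_pow n M l = (\<Sum>u\<in>closed_walks n l. \<Prod>t<l. M (u t) (u (Suc t)))"
proof -
  let ?S = "{..l} \<rightarrow>\<^sub>E {..<n}" and ?w = "\<lambda>u. \<Prod>t<l. M (u t) (u (Suc t))"
  have "trace_pow n M l = (\<Sum>u\<in>?S. \<Sum>i<n. if i = u 0 then of_bool (u l = u 0) * ?w u else 0)"
  proof -
    have "trace_pow n M l = (\<Sum>i<n. \<Sum>u\<in>?S. of_bool (u 0 = i) * of_bool (u l = i) * ?w u)"
      by (simp add: trace_pow_def mpow_walks)
    also have "\<dots> = (\<Sum>u\<in>?S. \<Sum>i<n. of_bool (u 0 = i) * of_bool (u l = i) * ?w u)"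
      by (rule sum.swap)
    also have "\<dots> = (\<Sum>u\<in>?S. \<Sum>i<n. if i = u 0 then of_bool (u l = u 0) * ?w u else 0)"
      by (intro sum.cong refl) auto
    finally show ?thesis .
  qed
  also have "\<dots> = (\<Sum>u\<in>?S. if u l = u 0 then ?w u else 0)"
    by (intro sum.cong refl) (auto simp: PiE_iff)
  also have "\<dots> = (\<Sum>u\<in>closed_walks n l. ?w u)"
    unfolding closed_walks_def by (rule sum.inter_filter[symmetric]) (auto intro: finite_PiE)
  finally show ?thesis .
qed

section \<open>Expected traces as sums over walks with edge multiplicities\<close>

definition edge_mat :: "(nat \<times> nat \<Rightarrow> real) \<Rightarrow> nat \<Rightarrow> nat \<Rightarrow> real" where
  "edge_mat x i j = (if i = j then 0 else x (min i j, max i j))"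

lemma symm_edge_mat: "symm n (edge_mat x)"
  by (simp add: symm_def edge_mat_def min.commute max.commute)

definition step_edge :: "(nat \<Rightarrow> nat) \<Rightarrow> nat \<Rightarrow> nat \<times> nat" where
  "step_edge u t = (min (u t) (u (Suc t)), max (u t) (u (Suc t)))"

definition edge_mult :: "nat \<Rightarrow> (nat \<Rightarrow> nat) \<Rightarrow> nat \<times> nat \<Rightarrow> nat" where
  "edge_mult l u p = card {t \<in> {..<l}. step_edge u t = p}"

lemma finite_upper_pairs [simp]: "finite (upper_pairs n)"
  by (rule finite_subset[of _ "{..<n} \<times> {..<n}"]) (auto simp: upper_pairs_def)

lemma step_edge_upper:
  assumes "u \<in> {..l} \<rightarrow>\<^sub>E {..<n}" "t < l" "u t \<noteq> u (Suc t)"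
  shows "step_edge u t \<in> upper_pairs n"
  using assms by (auto simp: step_edge_def upper_pairs_def PiE_iff)

lemma walk_weight_edge_mat:
  assumes "u \<in> {..l} \<rightarrow>\<^sub>E {..<n}" "\<And>t. t < l \<Longrightarrow> u t \<noteq> u (Suc t)"
  shows "(\<Prod>t<l. edge_mat x (u t) (u (Suc t))) = (\<Prod>p\<in>upper_pairs n. x p ^ edge_mult l u p)"
proof -
  have "(\<Prod>t<l. edge_mat x (u t) (u (Suc t))) = (\<Prod>t<l. x (step_edge u t))"
    using assms(2) by (intro prod.cong) (auto simp: edge_mat_def step_edge_def)
  also have "\<dots> = (\<Prod>p\<in>upper_pairs n. \<Prod>t\<in>{t \<in> {..<l}. step_edge u t = p}. x (step_edge u t))"
    using step_edge_upper[OF assms(1)] assms(2) by (intro prod.group[symmetric]) auto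
  also have "\<dots> = (\<Prod>p\<in>upper_pairs n. x p ^ edge_mult l u p)"
    by (simp add: edge_mult_def)
  finally show ?thesis .
qed

text \<open>Powers of centred entries take both signs, so integrability is assumed in place of
  non-negativity.\<close>

lemma expectation_prod_Pi_pmf_signed:
  fixes f :: "'a \<Rightarrow> 'b \<Rightarrow> real"
  assumes "finite A" "\<And>x. x \<in> A \<Longrightarrow> integrable (measure_pmf (p x)) (f x)"
  shows "measure_pmf.expectation (Pi_pmf A d p) (\<lambda>y. \<Prod>x\<in>A. f x (y x))
    = (\<Prod>x\<in>A. measure_pmf.expectation (p x) (f x))"
proof -
  have comp: "p x = map_pmf (\<lambda>y. y x) (Pi_pmf A d p)" if "x \<in> A" for x
    using Pi_pmf_component[OF assms(1), of x d p] that by simp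
  have indep: "prob_space.indep_vars (measure_pmf (Pi_pmf A d p)) (\<lambda>_. borel) (\<lambda>x y. f x (y x)) A"
    using prob_space.indep_vars_compose2[OF prob_space_measure_pmf indep_vars_Pi_pmf[OF assms(1), of d p], of f "\<lambda>_. borel"]
    by simp
  have int: "integrable (measure_pmf (Pi_pmf A d p)) (\<lambda>y. f x (y x))" if "x \<in> A" for x
    using assms(2)[OF that] by (subst (asm) comp[OF that]) simp
  have "measure_pmf.expectation (Pi_pmf A d p) (\<lambda>y. \<Prod>x\<in>A. f x (y x))
      = (\<Prod>x\<in>A. measure_pmf.expectation (Pi_pmf A d p) (\<lambda>y. f x (y x)))"
    by (rule prob_space.indep_vars_lebesgue_integral[OF prob_space_measure_pmf assms(1) indep int])
  also have "\<dots> = (\<Prod>x\<in>A. measure_pmf.expectation (p x) (f x))"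
    by (intro prod.cong refl) (simp add: comp)
  finally show ?thesis .
qed

abbreviation edge_pmf :: "nat \<Rightarrow> (nat \<Rightarrow> nat \<Rightarrow> real) \<Rightarrow> (nat \<times> nat \<Rightarrow> bool) pmf" where
  "edge_pmf n q \<equiv> Pi_pmf (upper_pairs n) False (\<lambda>(i, j). bernoulli_pmf (q i j))"

lemma finite_set_edge_pmf: "finite (set_pmf (edge_pmf n q))"
  by (rule finite_subset[OF set_Pi_pmf_subset'])
    (auto simp: case_prod_unfold intro!: finite_PiE_dflt)

lemma integrable_edge_pmf [simp]: "integrable (measure_pmf (edge_pmf n q)) (f :: _ \<Rightarrow> real)"
  by (rule integrable_measure_pmf_finite[OF finite_set_edge_pmf])

definition loop_free :: "nat \<Rightarrow> (nat \<Rightarrow> nat) \<Rightarrow> bool" where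
  "loop_free l u \<longleftrightarrow> (\<forall>t<l. u t \<noteq> u (Suc t))"

text \<open>Stated for an arbitrary two-point law, so that it serves both the centred adjacency
  matrix and the comparison matrix. Edges off the walk have multiplicity 0 and contribute the factor
  1.\<close>

lemma expectation_trace_pow:
  fixes g :: "bool \<Rightarrow> real"
  assumes "0 \<le> q" "q \<le> 1"
  shows "measure_pmf.expectation (edge_pmf n (\<lambda>_ _. q)) (\<lambda>e. trace_pow n (edge_mat (\<lambda>p. g (e p))) l)
    = (\<Sum>u\<in>{u \<in> closed_walks n l. loop_free l u}. \<Prod>p\<in>upper_pairs n.
        q * g True ^ edge_mult l u p + (1 - q) * g False ^ edge_mult l u p)"
proof -
  have "measure_pmf.expectation (edge_pmf n (\<lambda>_ _. q)) (\<lambda>e. trace_pow n (edge_mat (\<lambda>p. g (e p))) l)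
    = (\<Sum>u\<in>closed_walks n l. measure_pmf.expectation (edge_pmf n (\<lambda>_ _. q))
        (\<lambda>e. \<Prod>t<l. edge_mat (\<lambda>p. g (e p)) (u t) (u (Suc t))))"
    unfolding trace_pow_walks by (rule Bochner_Integration.integral_sum) simp
  also have "\<dots> = (\<Sum>u\<in>closed_walks n l. if loop_free l u then \<Prod>p\<in>upper_pairs n.
        q * g True ^ edge_mult l u p + (1 - q) * g False ^ edge_mult l u p else 0)"
  proof (intro sum.cong refl)
    fix u assume u: "u \<in> closed_walks n l"
    show "measure_pmf.expectation (edge_pmf n (\<lambda>_ _. q))
        (\<lambda>e. \<Prod>t<l. edge_mat (\<lambda>p. g (e p)) (u t) (u (Suc t)))
      = (if loop_free l u then \<Prod>p\<in>upper_pairs n.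
        q * g True ^ edge_mult l u p + (1 - q) * g False ^ edge_mult l u p else 0)"
    proof (cases "loop_free l u")
      case True
      then have "(\<Prod>t<l. edge_mat (\<lambda>p. g (e p)) (u t) (u (Suc t)))
          = (\<Prod>p\<in>upper_pairs n. g (e p) ^ edge_mult l u p)" for e
        using u by (intro walk_weight_edge_mat) (auto simp: closed_walks_def loop_free_def)
      moreover have "measure_pmf.expectation (edge_pmf n (\<lambda>_ _. q)) (\<lambda>e. \<Prod>p\<in>upper_pairs n. g (e p) ^ edge_mult l u p)
        = (\<Prod>p\<in>upper_pairs n. measure_pmf.expectation ((\<lambda>(i, j). bernoulli_pmf q) p) (\<lambda>b. g b ^ edge_mult l u p))"
        by (rule expectation_prod_Pi_pmf_signed)
          (auto intro!: integrable_measure_pmf_finite)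
      ultimately show ?thesis using True assms
        by (simp add: case_prod_unfold mult.commute)
    next
      case False
      then obtain t where "t < l" "u t = u (Suc t)" by (auto simp: loop_free_def)
      then have 0: "(\<Prod>t<l. edge_mat (\<lambda>p. g (e p)) (u t) (u (Suc t))) = 0" for e
        by (intro prod_zero) (auto simp: edge_mat_def)
      show ?thesis unfolding 0 using False by simp
    qed
  qed
  also have "\<dots> = (\<Sum>u\<in>{u \<in> closed_walks n l. loop_free l u}. \<Prod>p\<in>upper_pairs n.
        q * g True ^ edge_mult l u p + (1 - q) * g False ^ edge_mult l u p)"
    by (rule sum.inter_filter[symmetric]) (rule finite_closed_walks)
  finally show ?thesis .
qed

text \<open>Only these walks contribute to the expected trace of a power of a centred random matrix.\<close>

definition recurrent :: "nat \<Rightarrow> (nat \<Rightarrow> nat) \<Rightarrow> bool" where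
  "recurrent l u \<longleftrightarrow> u l = u 0 \<and> loop_free l u \<and>
     (\<forall>t<l. \<exists>s<l. s \<noteq> t \<and> {u s, u (Suc s)} = {u t, u (Suc t)})"

definition recurrent_walks :: "nat \<Rightarrow> nat \<Rightarrow> (nat \<Rightarrow> nat) set" where
  "recurrent_walks n l = {u \<in> {..l} \<rightarrow>\<^sub>E {..<n}. recurrent l u}"

lemma finite_recurrent_walks: "finite (recurrent_walks n l)"
  unfolding recurrent_walks_def by (rule finite_subset[of _ "{..l} \<rightarrow>\<^sub>E {..<n}"]) (auto intro: finite_PiE)

lemma step_edge_eq_iff: "step_edge u s = step_edge u t \<longleftrightarrow> {u s, u (Suc s)} = {u t, u (Suc t)}"
  by (auto simp: step_edge_def doubleton_eq_iff min_def max_def split: if_splits)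

lemma recurrent_iff_edge_mult:
  "recurrent l u \<longleftrightarrow> u l = u 0 \<and> loop_free l u \<and> (\<forall>p. edge_mult l u p \<noteq> 1)"
proof -
  have "(\<forall>t<l. \<exists>s<l. s \<noteq> t \<and> step_edge u s = step_edge u t) \<longleftrightarrow> (\<forall>p. edge_mult l u p \<noteq> 1)"
  proof
    assume *: "\<forall>t<l. \<exists>s<l. s \<noteq> t \<and> step_edge u s = step_edge u t"
    show "\<forall>p. edge_mult l u p \<noteq> 1"
    proof (intro allI notI)
      fix p assume "edge_mult l u p = 1"
      then obtain t where t: "{t \<in> {..<l}. step_edge u t = p} = {t}"
        unfolding edge_mult_def by (auto simp: card_1_singleton_iff)
      then have "t < l" "step_edge u t = p" by auto
      with * obtain s where "s < l" "s \<noteq> t" "step_edge u s = p" by auto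
      with t show False by auto
    qed
  next
    assume *: "\<forall>p. edge_mult l u p \<noteq> 1"
    show "\<forall>t<l. \<exists>s<l. s \<noteq> t \<and> step_edge u s = step_edge u t"
    proof (intro allI impI, rule ccontr)
      fix t assume "t < l" and "\<not> (\<exists>s<l. s \<noteq> t \<and> step_edge u s = step_edge u t)"
      then have "{s \<in> {..<l}. step_edge u s = step_edge u t} = {t}" by auto
      then have "edge_mult l u (step_edge u t) = 1" by (simp add: edge_mult_def)
      with * show False by blast
    qed
  qed
  then show ?thesis by (simp add: recurrent_def step_edge_eq_iff)
qed

text \<open>The kernel is the partition of the times \<open>0, ..., l\<close> by the vertex visited;
  it is the walk shape of the comparison.\<close>

definition same_kernel :: "nat \<Rightarrow> (nat \<Rightarrow> nat) \<Rightarrow> (nat \<Rightarrow> nat) \<Rightarrow> bool" where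
  "same_kernel l u w \<longleftrightarrow> (\<forall>s\<le>l. \<forall>t\<le>l. u s = u t \<longleftrightarrow> w s = w t)"

lemma same_kernel_sym: "same_kernel l u w \<longleftrightarrow> same_kernel l w u"
  by (auto simp: same_kernel_def)

lemma same_kernelD:
  "same_kernel l u w \<Longrightarrow> s \<le> l \<Longrightarrow> t \<le> l \<Longrightarrow> u s = u t \<longleftrightarrow> w s = w t"
  by (auto simp: same_kernel_def)

lemma recurrent_same_kernel:
  assumes "same_kernel l u w" "recurrent l u"
  shows "recurrent l w"
proof -
  have "w l = w 0" using assms same_kernelD[OF assms(1), of l 0] by (simp add: recurrent_def)
  moreover have "loop_free l w"
    using assms(2) same_kernelD[OF assms(1)] by (auto simp: recurrent_def loop_free_def)
  moreover have "{w s, w (Suc s)} = {w t, w (Suc t)}"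
    if "{u s, u (Suc s)} = {u t, u (Suc t)}" "s < l" "t < l" for s t
    using that same_kernelD[OF assms(1), of s t] same_kernelD[OF assms(1), of s "Suc t"]
      same_kernelD[OF assms(1), of "Suc s" t] same_kernelD[OF assms(1), of "Suc s" "Suc t"]
    by (simp add: doubleton_eq_iff)
  ultimately show ?thesis using assms(2) unfolding recurrent_def by metis
qed

definition walk_size :: "nat \<Rightarrow> (nat \<Rightarrow> nat) \<Rightarrow> nat" where
  "walk_size l u = card (u ` {..l})"

text \<open>Walks with the same kernel as \<open>u\<close> correspond to injections of the vertices of \<open>u\<close>.\<close>

lemma card_same_kernel:
  "card {w \<in> {..l} \<rightarrow>\<^sub>E {..<n}. same_kernel l u w} = (\<Prod>i<walk_size l u. n - i)"
proof -
  let ?I = "u ` {..l}"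
  have "bij_betw (\<lambda>f. restrict (f \<circ> u) {..l}) {f \<in> ?I \<rightarrow>\<^sub>E {..<n}. inj_on f ?I}
    {w \<in> {..l} \<rightarrow>\<^sub>E {..<n}. same_kernel l u w}"
  proof (rule bij_betw_imageI)
    show "inj_on (\<lambda>f. restrict (f \<circ> u) {..l}) {f \<in> ?I \<rightarrow>\<^sub>E {..<n}. inj_on f ?I}"
    proof (rule inj_onI)
      fix f g assume f: "f \<in> {f \<in> ?I \<rightarrow>\<^sub>E {..<n}. inj_on f ?I}"
        and g: "g \<in> {f \<in> ?I \<rightarrow>\<^sub>E {..<n}. inj_on f ?I}"
        and eq: "restrict (f \<circ> u) {..l} = restrict (g \<circ> u) {..l}"
      have "f (u t) = g (u t)" if "t \<le> l" for t
        using fun_cong[OF eq, of t] that by simp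
      then show "f = g" using f g by (intro PiE_ext[of f ?I "\<lambda>_. {..<n}" g]) auto
    qed
    show "(\<lambda>f. restrict (f \<circ> u) {..l}) ` {f \<in> ?I \<rightarrow>\<^sub>E {..<n}. inj_on f ?I}
      = {w \<in> {..l} \<rightarrow>\<^sub>E {..<n}. same_kernel l u w}" (is "?L = ?R")
    proof (intro equalityI subsetI)
      fix w assume "w \<in> ?L"
      then obtain f where f: "f \<in> ?I \<rightarrow>\<^sub>E {..<n}" "inj_on f ?I" and w: "w = restrict (f \<circ> u) {..l}"
        by auto
      have "w \<in> {..l} \<rightarrow>\<^sub>E {..<n}" using f(1) unfolding w by (auto simp: PiE_iff)
      moreover have "same_kernel l u w"
        unfolding same_kernel_def w using inj_on_eq_iff[OF f(2)] by auto
      ultimately show "w \<in> ?R" by simp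
    next
      fix w assume "w \<in> ?R"
      then have w: "w \<in> {..l} \<rightarrow>\<^sub>E {..<n}" and ker: "same_kernel l u w" by auto
      define f where "f = restrict (\<lambda>a. w (SOME t. t \<le> l \<and> u t = a)) ?I"
      have f: "f (u t) = w t" if "t \<le> l" for t
      proof -
        have "(SOME s. s \<le> l \<and> u s = u t) \<le> l \<and> u (SOME s. s \<le> l \<and> u s = u t) = u t"
          by (rule someI[of _ t]) (use that in simp)
        then have "w (SOME s. s \<le> l \<and> u s = u t) = w t"
          using same_kernelD[OF ker] that by blast
        then show ?thesis using that by (simp add: f_def)
      qed
      have "f \<in> ?I \<rightarrow>\<^sub>E {..<n}"
      proof (rule PiE_I)
        fix a assume "a \<in> ?I"
        then show "f a \<in> {..<n}" using f w by (auto simp: PiE_iff)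
      qed (simp add: f_def)
      moreover have "inj_on f ?I"
        using f same_kernelD[OF ker] by (auto simp: inj_on_def)
      moreover have "w = restrict (f \<circ> u) {..l}"
        using w f by (intro PiE_ext[of w "{..l}" "\<lambda>_. {..<n}"]) (auto simp: PiE_iff)
      ultimately show "w \<in> ?L" by blast
    qed
  qed
  then have "card {w \<in> {..l} \<rightarrow>\<^sub>E {..<n}. same_kernel l u w} = card {f \<in> ?I \<rightarrow>\<^sub>E {..<n}. inj_on f ?I}"
    by (simp add: bij_betw_same_card)
  also have "\<dots> = (\<Prod>i<walk_size l u. n - i)"
    using card_inj_on_subset_funcset[of ?I "{..<n}" ?I] by (simp add: walk_size_def lessThan_atLeast0)
  finally show ?thesis .
qed

lemma walk_size_same_kernel:
  assumes "same_kernel l u w"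
  shows "walk_size l u = walk_size l w"
proof -
  have "bij_betw (\<lambda>a. w (SOME t. t \<le> l \<and> u t = a)) (u ` {..l}) (w ` {..l})"
  proof -
    have f: "w (SOME s. s \<le> l \<and> u s = u t) = w t" if "t \<le> l" for t
    proof -
      have "(SOME s. s \<le> l \<and> u s = u t) \<le> l \<and> u (SOME s. s \<le> l \<and> u s = u t) = u t"
        by (rule someI[of _ t]) (use that in simp)
      then show ?thesis using same_kernelD[OF assms] that by blast
    qed
    show ?thesis
      using f same_kernelD[OF assms] by (intro bij_betw_imageI) (auto simp: inj_on_def image_iff)
  qed
  then show ?thesis by (simp add: walk_size_def bij_betw_same_card)
qed

section \<open>Vertices against edges of a walk\<close>

definition walk_edges :: "nat \<Rightarrow> (nat \<Rightarrow> nat) \<Rightarrow> (nat \<times> nat) set" where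
  "walk_edges l u = step_edge u ` {..<l}"

text \<open>A step to a new vertex uses a new edge; only the starting vertex comes for free.\<close>

lemma walk_size_le_edges: "walk_size l u \<le> Suc (card (walk_edges l u))"
proof (induction l)
  case (Suc l)
  have fin: "finite (walk_edges l u)" by (simp add: walk_edges_def)
  have edges: "walk_edges (Suc l) u = insert (step_edge u l) (walk_edges l u)"
    by (simp add: walk_edges_def lessThan_Suc)
  have size: "walk_size (Suc l) u = card (insert (u (Suc l)) (u ` {..l}))"
    by (simp add: walk_size_def atMost_Suc)
  show ?case
  proof (cases "u (Suc l) \<in> u ` {..l}")
    case True
    then have "walk_size (Suc l) u = walk_size l u"
      unfolding size by (simp add: insert_absorb walk_size_def)
    moreover have "card (walk_edges l u) \<le> card (walk_edges (Suc l) u)"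
      by (intro card_mono) (auto simp: edges fin)
    ultimately show ?thesis using Suc.IH by simp
  next
    case False
    have "step_edge u l \<notin> walk_edges l u"
    proof
      assume "step_edge u l \<in> walk_edges l u"
      then obtain t where "t < l" "step_edge u l = step_edge u t" by (auto simp: walk_edges_def)
      then have "u (Suc l) = u t \<or> u (Suc l) = u (Suc t)"
        by (auto simp: step_edge_eq_iff doubleton_eq_iff)
      with \<open>t < l\<close> False show False by auto
    qed
    then have "card (walk_edges (Suc l) u) = Suc (card (walk_edges l u))" by (simp add: edges fin)
    moreover have "walk_size (Suc l) u = Suc (walk_size l u)"
      unfolding size using False by (simp add: walk_size_def)
    ultimately show ?thesis using Suc.IH by simp
  qed
qed (simp add: walk_size_def)

text \<open>Each edge takes at least two of the \<open>l\<close> steps. Hence a recurrent walk of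
  \<open>2 * m\<close> steps visits at most \<open>m + 1\<close> vertices.\<close>

lemma recurrent_edges_le:
  assumes "recurrent l u"
  shows "2 * card (walk_edges l u) \<le> l"
proof -
  have "2 * card (walk_edges l u) = (\<Sum>p\<in>walk_edges l u. 2)" by simp
  also have "\<dots> \<le> (\<Sum>p\<in>walk_edges l u. edge_mult l u p)"
  proof (intro sum_mono)
    fix p assume "p \<in> walk_edges l u"
    then have "edge_mult l u p \<noteq> 0" by (auto simp: edge_mult_def walk_edges_def)
    moreover have "edge_mult l u p \<noteq> 1" using assms unfolding recurrent_iff_edge_mult by blast
    ultimately show "2 \<le> edge_mult l u p" by linarith
  qed
  also have "\<dots> = (\<Sum>p\<in>walk_edges l u. \<Sum>t\<in>{t \<in> {..<l}. step_edge u t = p}. 1)"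
    by (simp add: edge_mult_def)
  also have "\<dots> = (\<Sum>t<l. 1)" by (rule sum.group) (auto simp: walk_edges_def)
  finally show ?thesis by simp
qed

section \<open>Moments of the entries and comparison of the two traces\<close>

lemma centred_bernoulli_moment:
  fixes p :: real
  assumes "0 \<le> p" "p \<le> 1" "j \<noteq> 1"
  shows "\<bar>p * (1 - p) ^ j + (1 - p) * (0 - p) ^ j\<bar> \<le> (if j = 0 then 1 else p)"
proof (cases "j = 0")
  case False
  then have j: "j \<ge> 2" using assms(3) by simp
  have "\<bar>p * (1 - p) ^ j + (1 - p) * (0 - p) ^ j\<bar> \<le> p * (1 - p) ^ j + (1 - p) * p ^ j"
    using assms by (intro order_trans[OF abs_triangle_ineq]) (simp add: abs_mult power_abs)
  \<comment> \<open>Centred entries have modulus at most 1, so every higher absolute moment is at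
    most the variance \<open>p * (1 - p)\<close>.\<close>
  also have "\<dots> \<le> p * (1 - p) ^ 2 + (1 - p) * p ^ 2"
    using assms j by (intro add_mono mult_left_mono power_decreasing) auto
  also have "\<dots> = p * (1 - p)" by (simp add: power2_eq_square algebra_simps)
  also have "\<dots> \<le> p * 1" using assms by (intro mult_left_mono) auto
  finally show ?thesis using False by simp
qed simp

text \<open>Recurrent walks may use an edge an odd number of times. Symmetric signs would give such
  walks expectation 0; the skewed law with values 2 and -1 is centred and has odd moments from the
  third on bounded below as well.\<close>

lemma reference_moment_ge:
  fixes j :: nat
  assumes "j \<noteq> 1"
  shows "1 \<le> (1 / 3) * 2 ^ j + (1 - 1 / 3) * (- 1 :: real) ^ j"
proof (cases "j = 0")
  case False
  then obtain i where i: "j = Suc (Suc i)" using assms by (cases j; cases "j - 1") auto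
  show ?thesis
  proof (cases "even i")
    case True
    then have "(- 1 :: real) ^ j = 1" by (simp add: i)
    then have eq: "(1 / 3) * 2 ^ j + (1 - 1 / 3) * (- 1 :: real) ^ j = (4 * 2 ^ i + 2) / 3"
      by (simp add: i)
    have "1 \<le> (4 * x + 2) / 3" if "1 \<le> x" for x :: real using that by simp
    from this[of "2 ^ i"] have "1 \<le> (4 * (2::real) ^ i + 2) / 3" by simp
    then show ?thesis by (simp only: eq)
  next
    case False
    then obtain h where "i = Suc h" by (cases i) auto
    moreover from this False have "(- 1 :: real) ^ j = - 1" by (simp add: i)
    ultimately have eq: "(1 / 3) * 2 ^ j + (1 - 1 / 3) * (- 1 :: real) ^ j = (8 * 2 ^ h - 2) / 3"
      by (simp add: i)
    have "1 \<le> (8 * x - 2) / 3" if "1 \<le> x" for x :: real using that by simp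
    from this[of "2 ^ h"] have "1 \<le> (8 * (2::real) ^ h - 2) / 3" by simp
    then show ?thesis by (simp only: eq)
  qed
qed simp

text \<open>An edge used exactly once contributes the mean \<open>2/3 - 2/3 = 0\<close>, which
  removes the other closed walks; each recurrent one contributes at least 1.\<close>

lemma card_recurrent_walks_le:
  "real (card (recurrent_walks r l)) \<le> measure_pmf.expectation (edge_pmf r (\<lambda>_ _. 1 / 3))
     (\<lambda>e. trace_pow r (edge_mat (\<lambda>p. if e p then 2 else - 1)) l)"
proof -
  let ?S = "{u \<in> closed_walks r l. loop_free l u}"
  let ?f = "\<lambda>u. \<Prod>p\<in>upper_pairs r. (1 / 3) * 2 ^ edge_mult l u p + (1 - 1 / 3) * (- 1 :: real) ^ edge_mult l u p"
  have sub: "recurrent_walks r l \<subseteq> ?S"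
    by (auto simp: recurrent_walks_def recurrent_def closed_walks_def)
  have fin: "finite ?S" using finite_closed_walks by simp
  have zero: "?f u = 0" if "u \<in> ?S - recurrent_walks r l" for u
  proof -
    from that have u: "u \<in> {..l} \<rightarrow>\<^sub>E {..<r}" "loop_free l u" and "u l = u 0" "\<not> recurrent l u"
      by (auto simp: closed_walks_def recurrent_walks_def)
    then obtain p where p: "edge_mult l u p = 1"
      unfolding recurrent_iff_edge_mult by blast
    then have "{t \<in> {..<l}. step_edge u t = p} \<noteq> {}"
      unfolding edge_mult_def by (metis card.empty zero_neq_one)
    then have "p \<in> upper_pairs r"
      using step_edge_upper[OF u(1)] u(2) by (auto simp: loop_free_def)
    with p show ?thesis by (intro prod_zero) (auto intro!: bexI[of _ p])
  qed
  have "real (card (recurrent_walks r l)) = (\<Sum>u\<in>recurrent_walks r l. 1)" by simp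
  also have "\<dots> \<le> (\<Sum>u\<in>recurrent_walks r l. ?f u)"
    by (intro sum_mono prod_ge_1 reference_moment_ge)
      (auto simp: recurrent_walks_def recurrent_iff_edge_mult)
  also have "\<dots> = (\<Sum>u\<in>?S. ?f u)"
    using zero by (intro sum.mono_neutral_left fin sub) auto
  also have "\<dots> = measure_pmf.expectation (edge_pmf r (\<lambda>_ _. 1 / 3))
     (\<lambda>e. trace_pow r (edge_mat (\<lambda>p. if e p then 2 else - 1)) l)"
    using expectation_trace_pow[of "1 / 3" r "\<lambda>b. if b then 2 else - 1" l] by simp
  finally show ?thesis .
qed

text \<open>Every edge used contributes at most \<open>p\<close>. As \<open>p <= 1\<close>, edges
  may be exchanged for vertices less one, which leaves a weight depending on the walk only through
  the number of its vertices.\<close>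

lemma expectation_trace_pow_centred_le:
  assumes "0 \<le> p" "p \<le> 1"
  shows "measure_pmf.expectation (edge_pmf n (\<lambda>_ _. p))
     (\<lambda>e. trace_pow n (edge_mat (\<lambda>q. of_bool (e q) - p)) l)
   \<le> (\<Sum>u\<in>recurrent_walks n l. p ^ (walk_size l u - 1))"
proof -
  let ?S = "{u \<in> closed_walks n l. loop_free l u}"
  let ?f = "\<lambda>u. \<Prod>q\<in>upper_pairs n. p * (1 - p) ^ edge_mult l u q + (1 - p) * (0 - p) ^ edge_mult l u q"
  have fin: "finite ?S" using finite_closed_walks by simp
  have sub: "recurrent_walks n l \<subseteq> ?S"
    by (auto simp: recurrent_walks_def recurrent_def closed_walks_def)
  have zero: "?f u = 0" if "u \<in> ?S - recurrent_walks n l" for u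
  proof -
    from that have u: "u \<in> {..l} \<rightarrow>\<^sub>E {..<n}" "loop_free l u" and "u l = u 0" "\<not> recurrent l u"
      by (auto simp: closed_walks_def recurrent_walks_def)
    then obtain q where q: "edge_mult l u q = 1"
      unfolding recurrent_iff_edge_mult by blast
    then have "{t \<in> {..<l}. step_edge u t = q} \<noteq> {}"
      unfolding edge_mult_def by (metis card.empty zero_neq_one)
    then have "q \<in> upper_pairs n"
      using step_edge_upper[OF u(1)] u(2) by (auto simp: loop_free_def)
    with q show ?thesis by (intro prod_zero) (auto intro!: bexI[of _ q])
  qed
  have le: "?f u \<le> p ^ (walk_size l u - 1)" if "u \<in> recurrent_walks n l" for u
  proof -
    from that have u: "u \<in> {..l} \<rightarrow>\<^sub>E {..<n}" "recurrent l u" by (auto simp: recurrent_walks_def)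
    have edges: "{q \<in> upper_pairs n. edge_mult l u q \<noteq> 0} = walk_edges l u"
      using step_edge_upper[OF u(1)] u(2)
      by (auto simp: edge_mult_def walk_edges_def recurrent_def loop_free_def)
        (metis imageI lessThan_iff)
    have "?f u \<le> (\<Prod>q\<in>upper_pairs n. \<bar>p * (1 - p) ^ edge_mult l u q + (1 - p) * (0 - p) ^ edge_mult l u q\<bar>)"
      by (rule order_trans[OF abs_ge_self]) (simp add: abs_prod)
    also have "\<dots> \<le> (\<Prod>q\<in>upper_pairs n. if edge_mult l u q = 0 then 1 else p)"
      using u(2) by (intro prod_mono conjI centred_bernoulli_moment assms)
        (auto simp: recurrent_iff_edge_mult)
    also have "\<dots> = p ^ card (walk_edges l u)"
      by (simp add: prod.If_cases edges[symmetric] Int_def)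
    also have "\<dots> \<le> p ^ (walk_size l u - 1)"
      using walk_size_le_edges[of l u] assms by (intro power_decreasing) auto
    finally show ?thesis .
  qed
  have "measure_pmf.expectation (edge_pmf n (\<lambda>_ _. p))
     (\<lambda>e. trace_pow n (edge_mat (\<lambda>q. of_bool (e q) - p)) l) = (\<Sum>u\<in>?S. ?f u)"
    using expectation_trace_pow[OF assms, of n "\<lambda>b. of_bool b - p" l] by simp
  also have "\<dots> = (\<Sum>u\<in>recurrent_walks n l. ?f u)"
    using zero by (intro sum.mono_neutral_right fin sub) auto
  also have "\<dots> \<le> (\<Sum>u\<in>recurrent_walks n l. p ^ (walk_size l u - 1))"
    by (intro sum_mono le)
  finally show ?thesis .
qed

text \<open>Factor by factor, \<open>(n - i) * p <= (n - 1) * p <= r - m <= r - i\<close> for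
  \<open>1 <= i <= m\<close>; the factors at \<open>i = 0\<close> are the extra \<open>n\<close> and
  \<open>r\<close>. This is why \<open>r = k + m\<close> is taken later: even the last of
  \<open>m + 1\<close> vertices then has \<open>k\<close> choices left.\<close>

lemma falling_factorial_ratio:
  fixes p :: real
  assumes "0 \<le> p" "n > 0" "(real n - 1) * p \<le> real r - real m" "m < r"
  shows "v \<le> m \<Longrightarrow> real (\<Prod>i<Suc v. n - i) * p ^ v * real r \<le> real n * real (\<Prod>i<Suc v. r - i)"
proof (induction v)
  case (Suc v)
  have "real (n - Suc v) * p \<le> (real n - 1) * p" using assms by (intro mult_right_mono) auto
  also have "\<dots> \<le> real r - real m" by fact
  also have "\<dots> \<le> real (r - Suc v)" using Suc.prems assms(4) by simp
  finally have 1: "real (n - Suc v) * p \<le> real (r - Suc v)" .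
  have prod_Suc: "real (\<Prod>i<Suc (Suc v). k - i) = real (\<Prod>i<Suc v. k - i) * real (k - Suc v)" for k
    by (simp only: prod.lessThan_Suc[of _ "Suc v"] of_nat_mult)
  have "real (\<Prod>i<Suc (Suc v). n - i) * p ^ Suc v * real r
      = (real (\<Prod>i<Suc v. n - i) * p ^ v * real r) * (real (n - Suc v) * p)"
    by (simp only: prod_Suc power_Suc mult_ac)
  also have "\<dots> \<le> (real n * real (\<Prod>i<Suc v. r - i)) * real (r - Suc v)"
  proof (rule mult_mono)
    show "real (\<Prod>i<Suc v. n - i) * p ^ v * real r \<le> real n * real (\<Prod>i<Suc v. r - i)"
      using Suc by simp
    show "0 \<le> real n * real (\<Prod>i<Suc v. r - i)" by (intro mult_nonneg_nonneg of_nat_0_le_iff)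
  qed (use 1 assms(1) in auto)
  also have "\<dots> = real n * real (\<Prod>i<Suc (Suc v). r - i)"
    by (simp only: prod_Suc mult_ac)
  finally show ?case .
qed simp

text \<open>Comparison with a matrix whose dimension is of the order of the row variance, following
  Bandeira and van Handel: walks on \<open>n\<close> and on \<open>r\<close> vertices are matched by their kernels, and each
  kernel on \<open>v\<close> vertices weighs at most \<open>n / r\<close> times as much on the left as on the right.\<close>

lemma trace_comparison:
  assumes "0 \<le> p" "p \<le> 1" "n > 0" "(real n - 1) * p \<le> real r - real m" "m < r"
  shows "measure_pmf.expectation (edge_pmf n (\<lambda>_ _. p))
     (\<lambda>e. trace_pow n (edge_mat (\<lambda>q. of_bool (e q) - p)) (2 * m))
   \<le> real n / real r * measure_pmf.expectation (edge_pmf r (\<lambda>_ _. 1 / 3))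
     (\<lambda>e. trace_pow r (edge_mat (\<lambda>q. if e q then 2 else - 1)) (2 * m))"
proof -
  let ?l = "2 * m"
  let ?U = "recurrent_walks n ?l" and ?W = "recurrent_walks r ?l"
  let ?ff = "\<lambda>n v. real (\<Prod>i<v. n - i)"
  have card_ker: "real (card {w \<in> recurrent_walks N ?l. same_kernel ?l u w}) = ?ff N (walk_size ?l u)"
    if "recurrent ?l u" for u N
  proof -
    have "{w \<in> recurrent_walks N ?l. same_kernel ?l u w} = {w \<in> {..?l} \<rightarrow>\<^sub>E {..<N}. same_kernel ?l u w}"
      using recurrent_same_kernel[OF _ that] by (auto simp: recurrent_walks_def)
    then show ?thesis by (simp only: card_same_kernel)
  qed
  have size: "1 \<le> walk_size ?l u \<and> walk_size ?l u \<le> Suc m" if "recurrent ?l u" for u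
  proof -
    have "u ` {..?l} \<noteq> {}" by simp
    then have "walk_size ?l u \<noteq> 0" by (simp add: walk_size_def)
    moreover have "walk_size ?l u \<le> Suc m"
      using recurrent_edges_le[OF that] walk_size_le_edges[of ?l u] by linarith
    ultimately show ?thesis by simp
  qed
  have ff_pos: "?ff r (walk_size ?l u) > 0" if "recurrent ?l u" for u
    using size[OF that] assms(5) by (auto intro!: prod_pos)
  have cancel: "0 < a \<Longrightarrow> a * (b / a) = b" for a b :: real by simp
  \<comment> \<open>Double counting of pairs of walks with equal kernels: the weight of
    \<open>u\<close> is shared equally among the walks on \<open>r\<close> vertices with its kernel.
    Their number is a falling factorial, positive since \<open>m < r\<close>.\<close>
  have "(\<Sum>u\<in>?U. p ^ (walk_size ?l u - 1))
      = (\<Sum>u\<in>?U. \<Sum>w\<in>?W. if same_kernel ?l u w then p ^ (walk_size ?l w - 1) / ?ff r (walk_size ?l w) else 0)"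
  proof (intro sum.cong refl)
    fix u assume "u \<in> ?U"
    then have u: "recurrent ?l u" by (simp add: recurrent_walks_def)
    have "(\<Sum>w\<in>?W. if same_kernel ?l u w then p ^ (walk_size ?l w - 1) / ?ff r (walk_size ?l w) else 0)
      = (\<Sum>w\<in>{w \<in> ?W. same_kernel ?l u w}. p ^ (walk_size ?l w - 1) / ?ff r (walk_size ?l w))"
      by (rule sum.inter_filter[symmetric]) (rule finite_recurrent_walks)
    also have "\<dots> = (\<Sum>w\<in>{w \<in> ?W. same_kernel ?l u w}. p ^ (walk_size ?l u - 1) / ?ff r (walk_size ?l u))"
      by (intro sum.cong refl) (auto dest: walk_size_same_kernel)
    also have "\<dots> = p ^ (walk_size ?l u - 1)"
      by (simp only: sum_constant card_ker[OF u] cancel[OF ff_pos[OF u]])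
    finally show "p ^ (walk_size ?l u - 1) = (\<Sum>w\<in>?W. if same_kernel ?l u w
      then p ^ (walk_size ?l w - 1) / ?ff r (walk_size ?l w) else 0)" ..
  qed
  also have "\<dots> = (\<Sum>w\<in>?W. \<Sum>u\<in>?U. if same_kernel ?l u w then p ^ (walk_size ?l w - 1) / ?ff r (walk_size ?l w) else 0)"
    by (rule sum.swap)
  also have "\<dots> \<le> (\<Sum>w\<in>?W. real n / real r)"
  proof (intro sum_mono)
    fix w assume "w \<in> ?W"
    then have w: "recurrent ?l w" by (simp add: recurrent_walks_def)
    obtain v where v: "walk_size ?l w = Suc v" "v \<le> m" using size[OF w] by (cases "walk_size ?l w") auto
    have "(\<Sum>u\<in>?U. if same_kernel ?l u w then p ^ (walk_size ?l w - 1) / ?ff r (walk_size ?l w) else 0)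
      = (\<Sum>u\<in>{u \<in> ?U. same_kernel ?l u w}. p ^ (walk_size ?l w - 1) / ?ff r (walk_size ?l w))"
      by (rule sum.inter_filter[symmetric]) (rule finite_recurrent_walks)
    also have "\<dots> = ?ff n (Suc v) * p ^ v / ?ff r (Suc v)"
      using card_ker[OF w, of n] by (simp add: v(1) same_kernel_sym[of _ _ w] del: of_nat_prod)
    also have "\<dots> \<le> real n / real r"
      using falling_factorial_ratio[OF assms(1,3,4,5) v(2)] ff_pos[OF w] assms(5)
      by (simp add: v(1) divide_simps mult_ac del: of_nat_prod prod.lessThan_Suc)
    finally show "(\<Sum>u\<in>?U. if same_kernel ?l u w then p ^ (walk_size ?l w - 1) / ?ff r (walk_size ?l w) else 0)
      \<le> real n / real r" .
  qed
  also have "\<dots> = real n / real r * real (card ?W)" by simp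
  also have "\<dots> \<le> real n / real r * measure_pmf.expectation (edge_pmf r (\<lambda>_ _. 1 / 3))
     (\<lambda>e. trace_pow r (edge_mat (\<lambda>q. if e q then 2 else - 1)) (2 * m))"
    by (intro mult_left_mono card_recurrent_walks_le) simp
  finally show ?thesis
    using expectation_trace_pow_centred_le[OF assms(1,2), of n ?l] by linarith
qed

subsection \<open>Concentration for sums of centred Bernoulli variables\<close>

lemma mgf_centred_bernoulli:
  fixes q s :: real
  assumes "0 \<le> q" "q \<le> 1"
  shows "measure_pmf.expectation (bernoulli_pmf q) (\<lambda>b. exp (s * (of_bool b - q))) \<le> exp (s\<^sup>2 / 8)"
proof -
  \<comment> \<open>Stated for any centred \<open>f\<close> into a unit interval, so that negative
    \<open>s\<close> follows by reflecting the variable.\<close>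
  have pos: "measure_pmf.expectation (bernoulli_pmf q) (\<lambda>b. exp (t * f b)) \<le> exp (t\<^sup>2 / 8)"
    if "t > 0" and f: "\<And>b. f b \<in> {c..c + 1}" "q * f True + (1 - q) * f False = 0" for t c f
  proof -
    interpret interval_bounded_random_variable "measure_pmf (bernoulli_pmf q)" f c "c + 1"
      by unfold_locales (use f in auto)
    have "ennreal (measure_pmf.expectation (bernoulli_pmf q) (\<lambda>b. exp (t * f b)))
        = nn_integral (bernoulli_pmf q) (\<lambda>b. exp (t * f b))"
      by (intro nn_integral_eq_integral[symmetric]) (auto intro!: integrable_measure_pmf_finite)
    also have "\<dots> \<le> ennreal (exp (t\<^sup>2 * (c + 1 - c)\<^sup>2 / 8))"
      using f(2) assms by (intro Hoeffdings_lemma_nn_integral_0 that) (simp add: mult.commute)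
    finally show ?thesis by (simp add: ennreal_le_iff)
  qed
  consider "s > 0" | "s = 0" | "s < 0" by linarith
  then show ?thesis
  proof cases
    case 1
    then show ?thesis
      by (intro pos[of s _ "- q"]) (auto simp: of_bool_def algebra_simps)
  next
    case 3
    have "measure_pmf.expectation (bernoulli_pmf q) (\<lambda>b. exp (- s * (q - of_bool b))) \<le> exp ((- s)\<^sup>2 / 8)"
      using 3 by (intro pos[of "- s" _ "q - 1"]) (auto simp: of_bool_def algebra_simps)
    then show ?thesis by (simp add: algebra_simps)
  qed simp
qed

definition centred_sum :: "nat \<Rightarrow> (nat \<Rightarrow> nat \<Rightarrow> real) \<Rightarrow> (nat \<times> nat \<Rightarrow> real) \<Rightarrow> (nat \<times> nat \<Rightarrow> bool) \<Rightarrow> real" where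
  "centred_sum n q a e = (\<Sum>p\<in>upper_pairs n. a p * (of_bool (e p) - q (fst p) (snd p)))"

lemma mgf_centred_sum:
  assumes "\<And>i j. 0 \<le> q i j \<and> q i j \<le> 1"
  shows "measure_pmf.expectation (edge_pmf n q) (\<lambda>e. exp (centred_sum n q a e))
    \<le> exp ((\<Sum>p\<in>upper_pairs n. (a p)\<^sup>2) / 8)"
proof -
  have "measure_pmf.expectation (edge_pmf n q) (\<lambda>e. exp (centred_sum n q a e))
      = measure_pmf.expectation (edge_pmf n q)
          (\<lambda>e. \<Prod>p\<in>upper_pairs n. exp (a p * (of_bool (e p) - q (fst p) (snd p))))"
    by (simp add: centred_sum_def exp_sum)
  also have "\<dots> = (\<Prod>p\<in>upper_pairs n. measure_pmf.expectation ((\<lambda>(i, j). bernoulli_pmf (q i j)) p)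
          (\<lambda>b. exp (a p * (of_bool b - q (fst p) (snd p)))))"
    by (rule expectation_prod_Pi_pmf_signed)
      (auto simp: case_prod_unfold intro!: integrable_measure_pmf_finite)
  also have "\<dots> \<le> (\<Prod>p\<in>upper_pairs n. exp ((a p)\<^sup>2 / 8))"
    unfolding case_prod_unfold
    by (intro prod_mono conjI mgf_centred_bernoulli)
      (use assms in \<open>auto intro!: Bochner_Integration.integral_nonneg\<close>)
  also have "\<dots> = exp ((\<Sum>p\<in>upper_pairs n. (a p)\<^sup>2) / 8)"
    by (simp add: exp_sum[symmetric] sum_divide_distrib)
  finally show ?thesis .
qed

lemma edge_pmf_Markov:
  assumes "\<And>e. 0 \<le> f e" "c > 0"
  shows "measure_pmf.prob (edge_pmf n q) {e. c \<le> f e} \<le> measure_pmf.expectation (edge_pmf n q) f / c"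
  using integral_Markov_inequality_measure[of "measure_pmf (edge_pmf n q)" f UNIV c] assms by simp

lemma centred_sum_uminus: "centred_sum n q (\<lambda>p. - a p) e = - centred_sum n q a e"
  by (simp add: centred_sum_def sum_negf)

lemma centred_sum_scale: "centred_sum n q (\<lambda>p. c * a p) e = c * centred_sum n q a e"
  by (simp add: centred_sum_def sum_distrib_left mult.assoc)

text \<open>Chernoff's bound with exponential parameter 1; any scaling is left to the coefficients
  \<open>a\<close>.\<close>

lemma centred_sum_tail:
  assumes "\<And>i j. 0 \<le> q i j \<and> q i j \<le> 1"
  shows "measure_pmf.prob (edge_pmf n q) {e. t \<le> \<bar>centred_sum n q a e\<bar>}
    \<le> 2 * exp ((\<Sum>p\<in>upper_pairs n. (a p)\<^sup>2) / 8) / exp t"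
proof -
  have one: "measure_pmf.prob (edge_pmf n q) {e. t \<le> centred_sum n q b e}
      \<le> exp ((\<Sum>p\<in>upper_pairs n. (b p)\<^sup>2) / 8) / exp t" for b
  proof -
    have "measure_pmf.prob (edge_pmf n q) {e. t \<le> centred_sum n q b e}
        \<le> measure_pmf.expectation (edge_pmf n q) (\<lambda>e. exp (centred_sum n q b e)) / exp t"
      using edge_pmf_Markov[of "\<lambda>e. exp (centred_sum n q b e)" "exp t"] by simp
    also have "\<dots> \<le> exp ((\<Sum>p\<in>upper_pairs n. (b p)\<^sup>2) / 8) / exp t"
      by (intro divide_right_mono mgf_centred_sum assms) simp
    finally show ?thesis .
  qed
  have "{e. t \<le> \<bar>centred_sum n q a e\<bar>}
      = {e. t \<le> centred_sum n q a e} \<union> {e. t \<le> centred_sum n q (\<lambda>p. - a p) e}"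
    by (auto simp: centred_sum_uminus abs_if)
  then have "measure_pmf.prob (edge_pmf n q) {e. t \<le> \<bar>centred_sum n q a e\<bar>}
      \<le> measure_pmf.prob (edge_pmf n q) {e. t \<le> centred_sum n q a e}
        + measure_pmf.prob (edge_pmf n q) {e. t \<le> centred_sum n q (\<lambda>p. - a p) e}"
    using measure_Un_le[of "{e. t \<le> centred_sum n q a e}" "measure_pmf (edge_pmf n q)"
        "{e. t \<le> centred_sum n q (\<lambda>p. - a p) e}"] by simp
  with one[of a] one[of "\<lambda>p. - a p"] show ?thesis by simp
qed

lemma power_le_fact_exp:
  fixes y :: real
  shows "y ^ (2 * m) \<le> fact (2 * m) * (exp y + exp (- y))"
proof -
  have "\<bar>y\<bar> ^ (2 * m) / fact (2 * m) \<le> exp \<bar>y\<bar>"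
    using sum_le_suminf[OF summable_exp_generic[of "\<bar>y\<bar>"], of "{2 * m}"]
    by (simp add: exp_def scaleR_conv_of_real divide_inverse mult.commute)
  also have "\<dots> \<le> exp y + exp (- y)" by (simp add: abs_if)
  finally show ?thesis by (simp add: field_simps power_even_abs)
qed

lemma centred_sum_moment:
  assumes "\<And>i j. 0 \<le> q i j \<and> q i j \<le> 1" "s > 0"
  shows "measure_pmf.expectation (edge_pmf n q) (\<lambda>e. centred_sum n q a e ^ (2 * m))
    \<le> 2 * fact (2 * m) * exp (s\<^sup>2 * (\<Sum>p\<in>upper_pairs n. (a p)\<^sup>2) / 8) / s ^ (2 * m)"
proof -
  let ?E = "measure_pmf.expectation (edge_pmf n q)"
  let ?S = "centred_sum n q"
  have mgf: "?E (\<lambda>e. exp (?S (\<lambda>p. t * a p) e)) \<le> exp (s\<^sup>2 * (\<Sum>p\<in>upper_pairs n. (a p)\<^sup>2) / 8)"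
    if "t\<^sup>2 = s\<^sup>2" for t
    using mgf_centred_sum[where n = n and q = q and a = "\<lambda>p. t * a p", OF assms(1)] that
    by (simp add: power_mult_distrib sum_distrib_left)
  have "s ^ (2 * m) * ?E (\<lambda>e. ?S a e ^ (2 * m)) = ?E (\<lambda>e. (s * ?S a e) ^ (2 * m))"
    by (simp add: power_mult_distrib)
  also have "\<dots> \<le> ?E (\<lambda>e. fact (2 * m) * (exp (s * ?S a e) + exp (- (s * ?S a e))))"
    by (intro integral_mono power_le_fact_exp) simp_all
  also have "\<dots> = fact (2 * m) * (?E (\<lambda>e. exp (?S (\<lambda>p. s * a p) e)) + ?E (\<lambda>e. exp (?S (\<lambda>p. - s * a p) e)))"
    by (simp add: centred_sum_uminus centred_sum_scale)
  also have "\<dots> \<le> fact (2 * m) * (exp (s\<^sup>2 * (\<Sum>p\<in>upper_pairs n. (a p)\<^sup>2) / 8)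
      + exp (s\<^sup>2 * (\<Sum>p\<in>upper_pairs n. (a p)\<^sup>2) / 8))"
    by (intro mult_left_mono add_mono mgf) auto
  finally show ?thesis using assms(2) by (simp add: field_simps)
qed

section \<open>Moments of the form of the comparison matrix\<close>

lemma bilinear_edge_mat:
  "dotp n f (mulv n (edge_mat x) g) = (\<Sum>(i, j)\<in>upper_pairs n. x (i, j) * (f i * g j + f j * g i))"
proof -
  let ?h = "\<lambda>(i, j). f i * edge_mat x i j * g j"
  let ?D = "(\<lambda>i. (i, i)) ` {..<n}"
  have split: "{..<n} \<times> {..<n} = (upper_pairs n \<union> prod.swap ` upper_pairs n) \<union> ?D"
    by (auto simp: upper_pairs_def image_iff)
  have "dotp n f (mulv n (edge_mat x) g) = (\<Sum>p\<in>{..<n} \<times> {..<n}. ?h p)"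
    by (simp add: dotp_def mulv_def sum_distrib_left sum.cartesian_product[symmetric] mult.assoc)
  also have "\<dots> = (\<Sum>p\<in>upper_pairs n \<union> prod.swap ` upper_pairs n. ?h p) + (\<Sum>p\<in>?D. ?h p)"
    unfolding split by (intro sum.union_disjoint finite_UnI finite_imageI finite_upper_pairs finite_lessThan)
      (auto simp: upper_pairs_def)
  also have "(\<Sum>p\<in>?D. ?h p) = 0" by (auto intro!: sum.neutral simp: edge_mat_def)
  also have "(\<Sum>p\<in>upper_pairs n \<union> prod.swap ` upper_pairs n. ?h p)
      = (\<Sum>p\<in>upper_pairs n. ?h p) + (\<Sum>p\<in>prod.swap ` upper_pairs n. ?h p)"
    by (intro sum.union_disjoint finite_UnI finite_imageI finite_upper_pairs finite_lessThan)
      (auto simp: upper_pairs_def)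
  also have "(\<Sum>p\<in>prod.swap ` upper_pairs n. ?h p) = (\<Sum>p\<in>upper_pairs n. ?h (prod.swap p))"
    by (subst sum.reindex) auto
  also have "(\<Sum>p\<in>upper_pairs n. ?h p) + (\<Sum>p\<in>upper_pairs n. ?h (prod.swap p)) + 0
      = (\<Sum>(i, j)\<in>upper_pairs n. x (i, j) * (f i * g j + f j * g i))"
    unfolding sum.distrib[symmetric] add_0_right
    by (intro sum.cong refl) (auto simp: upper_pairs_def edge_mat_def algebra_simps)
  finally show ?thesis .
qed

text \<open>On the net the coefficients have a sum of squares bounded independently of
  \<open>r\<close>. The form is therefore subgaussian with an absolute constant, which gives the
  growth \<open>m ^ m\<close>.\<close>

lemma reference_quadratic_form_moment:
  assumes z: "z \<in> lattice_net r" and "r > 0" "m > 0"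
  shows "measure_pmf.expectation (edge_pmf r (\<lambda>_ _. 1 / 3))
      (\<lambda>e. (dotp r (\<lambda>i. z i) (mulv r (edge_mat (\<lambda>p. if e p then 2 else - 1)) (\<lambda>i. z i)) / (4 * real r)) ^ (2 * m))
    \<le> 2 * (4 * exp 72 * real m) ^ m"
proof -
  \<comment> \<open>An entry 2 or -1 is \<open>3 * (of_bool b - 1/3)\<close>, and each pair occurs
    twice in the form: the coefficient is \<open>3 * 2 / 4 = 3 / 2\<close>.\<close>
  define a where "a = (\<lambda>(i, j). 3 / 2 * (z i * z j / real r))"
  have form: "dotp r (\<lambda>i. z i) (mulv r (edge_mat (\<lambda>p. if e p then 2 else - 1)) (\<lambda>i. z i)) / (4 * real r)
      = centred_sum r (\<lambda>_ _. 1 / 3) a e" for e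
    unfolding bilinear_edge_mat centred_sum_def sum_divide_distrib
    by (intro sum.cong refl) (use \<open>r > 0\<close> in \<open>auto simp: a_def field_simps\<close>)
  have "(\<Sum>i<r. (z i)\<^sup>2) \<le> int (16 * r)" using z by (simp add: lattice_net_def)
  then have "real_of_int (\<Sum>i<r. (z i)\<^sup>2) \<le> real_of_int (int (16 * r))" by (simp only: of_int_le_iff)
  then have norm: "(\<Sum>i<r. (real_of_int (z i))\<^sup>2) \<le> 16 * real r" by simp
  have "(\<Sum>p\<in>upper_pairs r. (a p)\<^sup>2) \<le> (\<Sum>p\<in>{..<r} \<times> {..<r}. (a p)\<^sup>2)"
    by (intro sum_mono2) (auto simp: upper_pairs_def)
  also have "\<dots> = 9 / 4 * (\<Sum>i<r. (real_of_int (z i))\<^sup>2)\<^sup>2 / (real r)\<^sup>2"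
  proof -
    have "(\<Sum>p\<in>{..<r} \<times> {..<r}. (a p)\<^sup>2) = (\<Sum>(i, j)\<in>{..<r} \<times> {..<r}. (a (i, j))\<^sup>2)"
      by (simp add: case_prod_unfold)
    also have "\<dots> = (\<Sum>i<r. \<Sum>j<r. (a (i, j))\<^sup>2)"
      by (rule sum.cartesian_product[symmetric])
    also have "\<dots> = (\<Sum>i<r. \<Sum>j<r. 9 / 4 / (real r)\<^sup>2 * ((real_of_int (z i))\<^sup>2 * (real_of_int (z j))\<^sup>2))"
      by (intro sum.cong refl) (simp add: a_def power_mult_distrib power_divide)
    also have "\<dots> = 9 / 4 / (real r)\<^sup>2 * ((\<Sum>i<r. (real_of_int (z i))\<^sup>2) * (\<Sum>i<r. (real_of_int (z i))\<^sup>2))"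
      by (subst sum_product) (simp only: sum_distrib_left)
    finally show ?thesis by (simp add: power2_eq_square)
  qed
  also have "\<dots> \<le> 9 / 4 * (16 * real r)\<^sup>2 / (real r)\<^sup>2"
    by (intro divide_right_mono mult_left_mono power_mono norm) (auto intro: sum_nonneg)
  also have "\<dots> = 576" using \<open>r > 0\<close> by (simp add: power_mult_distrib)
  finally have var: "(\<Sum>p\<in>upper_pairs r. (a p)\<^sup>2) \<le> 576" .
  \<comment> \<open>With \<open>s = sqrt m\<close> the exponential is at most
    \<open>exp (72 m)\<close>, where \<open>72 = 576 / 8\<close>, and the denominator
    \<open>m ^ m\<close> cancels half of the power \<open>(2 m) ^ (2 m)\<close> bounding the
    factorial.\<close>
  have "measure_pmf.expectation (edge_pmf r (\<lambda>_ _. 1 / 3)) (\<lambda>e. centred_sum r (\<lambda>_ _. 1 / 3) a e ^ (2 * m))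
    \<le> 2 * fact (2 * m) * exp ((sqrt m)\<^sup>2 * (\<Sum>p\<in>upper_pairs r. (a p)\<^sup>2) / 8) / sqrt m ^ (2 * m)"
    using \<open>m > 0\<close> by (intro centred_sum_moment) auto
  also have "\<dots> \<le> 2 * (2 * real m) ^ (2 * m) * exp (real m * 72) / real m ^ m"
  proof -
    have "fact (2 * m) \<le> (2 * real m) ^ (2 * m)"
      using fact_le_power[of "2 * m", where 'a = real] by simp
    moreover have "sqrt m ^ (2 * m) = real m ^ m" by (simp add: power_mult)
    moreover have "(sqrt m)\<^sup>2 * (\<Sum>p\<in>upper_pairs r. (a p)\<^sup>2) / 8 \<le> real m * 72"
      using mult_left_mono[OF var, of "real m"] by simp
    ultimately show ?thesis
      by (auto intro!: divide_right_mono mult_mono)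
  qed
  also have "\<dots> = 2 * (4 * exp 72 * real m) ^ m"
    using \<open>m > 0\<close> by (simp add: exp_of_nat_mult power_mult power_mult_distrib power2_eq_square)
  finally show ?thesis unfolding form .
qed

lemma reference_trace_le:
  assumes "r > 0" "m > 0"
  shows "measure_pmf.expectation (edge_pmf r (\<lambda>_ _. 1 / 3))
     (\<lambda>e. trace_pow r (edge_mat (\<lambda>q. if e q then 2 else - 1)) (2 * m))
   \<le> real r * ((3 * 2 ^ 16) ^ r * (2 * (4 * exp 72 * real m) ^ m))"
proof -
  let ?E = "measure_pmf.expectation (edge_pmf r (\<lambda>_ _. 1 / 3))"
  let ?Y = "\<lambda>e. edge_mat (\<lambda>q. if e q then 2 else - 1)"
  let ?q = "\<lambda>z e. (dotp r (\<lambda>i. real_of_int (z i)) (mulv r (?Y e) (\<lambda>i. real_of_int (z i))) / (4 * real r)) ^ (2 * m)"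
  have "?E (\<lambda>e. trace_pow r (?Y e) (2 * m)) \<le> ?E (\<lambda>e. real r * (\<Sum>z\<in>lattice_net r. ?q z e))"
    by (intro integral_mono trace_pow_le_net symm_edge_mat assms) auto
  also have "\<dots> = real r * (\<Sum>z\<in>lattice_net r. ?E (?q z))"
    by (subst integral_mult_right_zero, subst Bochner_Integration.integral_sum) auto
  also have "\<dots> \<le> real r * (\<Sum>z\<in>lattice_net r. 2 * (4 * exp 72 * real m) ^ m)"
    by (intro mult_left_mono sum_mono reference_quadratic_form_moment assms) auto
  also have "\<dots> = real r * (real (card (lattice_net r)) * (2 * (4 * exp 72 * real m) ^ m))" by simp
  also have "\<dots> \<le> real r * ((3 * 2 ^ 16) ^ r * (2 * (4 * exp 72 * real m) ^ m))"
    by (intro mult_left_mono mult_right_mono card_lattice_net) auto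
  finally show ?thesis .
qed

subsection \<open>The Erdos-Renyi graph\<close>

lemma sym_adj_mat_edge_mat: "sym_adj_mat n e = mat n n (\<lambda>(i, j). edge_mat (\<lambda>p. of_bool (e p)) i j)"
  by (simp add: sym_adj_mat_def edge_mat_def)

lemma prob_er_pmf: "measure_pmf.prob (er_pmf n p) S = measure_pmf.prob (edge_pmf n (\<lambda>_ _. p)) {e. sym_adj_mat n e \<in> S}"
  by (simp add: er_pmf_def sym_bernoulli_pmf_def vimage_def)

lemma mulv_edge_mat_diff:
  "mulv n (edge_mat (\<lambda>p. x p - y p)) f i = mulv n (edge_mat x) f i - mulv n (edge_mat y) f i"
  unfolding mulv_def sum_subtractf[symmetric]
  by (intro sum.cong refl) (auto simp: edge_mat_def algebra_simps)

lemma quadratic_form_const: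
  "dotp n x (mulv n (edge_mat (\<lambda>_. p)) x) = p * ((\<Sum>i<n. x i)\<^sup>2 - dotp n x x)"
proof -
  have "mulv n (edge_mat (\<lambda>_. p)) x i = p * (\<Sum>j<n. x j) - p * x i" if "i < n" for i
  proof -
    have "mulv n (edge_mat (\<lambda>_. p)) x i = (\<Sum>j<n. p * x j - (if j = i then p * x j else 0))"
      unfolding mulv_def by (intro sum.cong) (auto simp: edge_mat_def)
    then show ?thesis using that by (simp add: sum_subtractf sum_distrib_left)
  qed
  then have "dotp n x (mulv n (edge_mat (\<lambda>_. p)) x) = dotp n x (\<lambda>i. p * (\<Sum>j<n. x j) - p * x i)"
    by (intro dotp_cong) auto
  also have "\<dots> = dotp n x (\<lambda>i. p * (\<Sum>j<n. x j)) - p * dotp n x x"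
    by (simp add: dotp_linear)
  also have "dotp n x (\<lambda>i. p * (\<Sum>j<n. x j)) = p * (\<Sum>j<n. x j)\<^sup>2"
    unfolding dotp_def sum_distrib_right[symmetric] by (simp add: power2_eq_square)
  finally show ?thesis by (simp add: algebra_simps)
qed

text \<open>The first factor \<open>4 * exp 72\<close> comes from the moments of the form, the
  square from a net in dimension \<open>k + m <= 2 * m\<close>.\<close>

definition norm_const :: real where
  "norm_const = 4 * exp 72 * (3 * 2 ^ 16)\<^sup>2"

text \<open>The factor 8 is 4 times 2: \<open>m\<close> is at most 4 times the maximum of
  \<open>k\<close> and \<open>ln n\<close>, and a ratio \<open>1/2\<close> is kept for geometric
  decay. The factor \<open>exp 1\<close> absorbs \<open>n <= exp m\<close>.\<close>

definition test_const :: real where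
  "test_const = sqrt (8 * exp 1 * norm_const)"

lemma norm_const_pos: "norm_const > 0"
  by (simp add: norm_const_def)

lemma test_const_pos: "test_const > 0"
  using norm_const_pos by (simp add: test_const_def)

text \<open>The comparison is used with \<open>r = k + m\<close>, where
  \<open>(n - 1) * p = k\<close> meets its hypothesis with equality; the factor \<open>r\<close> of
  the reference trace then cancels the \<open>r\<close> in \<open>n / r\<close>.\<close>

lemma er_trace_le:
  assumes "k > 0" "k < n" "k \<le> m" "ln (real n) \<le> real m"
  defines "p \<equiv> real k / (real n - 1)"
  shows "measure_pmf.expectation (edge_pmf n (\<lambda>_ _. p))
     (\<lambda>e. trace_pow n (edge_mat (\<lambda>q. of_bool (e q) - p)) (2 * m)) \<le> 2 * (exp 1 * norm_const * real m) ^ m"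
proof -
  have p: "0 \<le> p" "p \<le> 1" "(real n - 1) * p = real k" using assms by (auto simp: p_def)
  let ?R = "measure_pmf.expectation (edge_pmf (k + m) (\<lambda>_ _. 1 / 3))
     (\<lambda>e. trace_pow (k + m) (edge_mat (\<lambda>q. if e q then 2 else - 1)) (2 * m))"
  let ?b = "2 * (4 * exp 72 * real m) ^ m"
  have "measure_pmf.expectation (edge_pmf n (\<lambda>_ _. p))
     (\<lambda>e. trace_pow n (edge_mat (\<lambda>q. of_bool (e q) - p)) (2 * m)) \<le> real n / real (k + m) * ?R"
    using assms p by (intro trace_comparison) auto
  also have "\<dots> \<le> real n / real (k + m) * (real (k + m) * ((3 * 2 ^ 16) ^ (k + m) * ?b))"
    using assms by (intro mult_left_mono reference_trace_le) auto
  also have "\<dots> = real n * ((3 * 2 ^ 16) ^ (k + m) * ?b)" using assms by simp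
  also have "\<dots> \<le> exp 1 ^ m * ((3 * 2 ^ 16) ^ (2 * m) * ?b)"
  proof (intro mult_mono)
    have "real n = exp (ln (real n))" using assms by simp
    also have "\<dots> \<le> exp (real m)" by (simp only: exp_le_cancel_iff assms)
    also have "\<dots> = exp 1 ^ m" by (simp add: exp_of_nat_mult[symmetric])
    finally show "real n \<le> exp 1 ^ m" .
    show "(3 * 2 ^ 16 :: real) ^ (k + m) \<le> (3 * 2 ^ 16) ^ (2 * m)"
      using assms by (intro power_increasing) auto
  qed auto
  also have "\<dots> = 2 * (exp 1 * norm_const * real m) ^ m"
  proof -
    have "(3 * 2 ^ 16 :: real) ^ (2 * m) = ((3 * 2 ^ 16)\<^sup>2) ^ m" by (rule power_mult)
    then show ?thesis by (simp only: norm_const_def power_mult_distrib mult_ac)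
  qed
  finally show ?thesis .
qed

lemma er_second_eigenvalue_tail:
  assumes "k > 0" "k < n"
  defines "p \<equiv> real k / (real n - 1)"
  shows "measure_pmf.prob (er_pmf n p)
    {A. test_const * max (sqrt (real k)) (sqrt (ln (real n))) \<le> second_eigenvalue A} \<le> 2 * (1 / 2) ^ k"
proof -
  let ?\<theta> = "test_const * max (sqrt (real k)) (sqrt (ln (real n)))"
  \<comment> \<open>The sum dominates both \<open>k\<close> and \<open>ln n\<close> and, as
    \<open>k >= 1\<close>, stays within a constant factor of their maximum.\<close>
  define m where "m = k + nat \<lceil>ln (real n)\<rceil>"
  have ln: "0 \<le> ln (real n)" using assms by simp
  have m: "k \<le> m" "ln (real n) \<le> real m" "m > 0"
    using assms by (auto simp: m_def) linarith
  have "real m \<le> real k + ln (real n) + 1" using ln by (simp add: m_def)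
  moreover have "real k \<ge> 1" using assms by simp
  ultimately have m4: "real m \<le> 4 * max (real k) (ln (real n))" using ln by linarith
  let ?M = "\<lambda>e. edge_mat (\<lambda>q. of_bool (e q) - p)"
  have p: "0 \<le> p" using assms by (simp add: p_def)
  have \<theta>: "?\<theta> > 0" using test_const_pos assms by (auto simp: less_max_iff_disj)
  have sub: "?\<theta> ^ (2 * m) \<le> trace_pow n (?M e) (2 * m)" if "?\<theta> \<le> second_eigenvalue (sym_adj_mat n e)" for e
  proof -
    let ?A = "edge_mat (\<lambda>q. of_bool (e q))"
    obtain x where x: "dotp n (\<lambda>_. 1) x = 0" "dotp n x x > 0"
      "second_eigenvalue (mat n n (\<lambda>(i, j). ?A i j)) * dotp n x x \<le> dotp n x (mulv n ?A x)"
      using second_eigenvalue_upper_witness[OF symm_edge_mat, of n "\<lambda>_. 1" "\<lambda>q. of_bool (e q)"] assms by auto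
    have "?\<theta> * dotp n x x \<le> second_eigenvalue (sym_adj_mat n e) * dotp n x x"
      using that x(2) by (intro mult_right_mono) auto
    also have "\<dots> \<le> dotp n x (mulv n ?A x)" using x(3) by (simp add: sym_adj_mat_edge_mat)
    \<comment> \<open>Centring subtracts \<open>p * (J - I)\<close> with \<open>J\<close> the
      all-ones matrix. On \<open>x\<close> the part \<open>J\<close> vanishes, and the rest adds
      \<open>p\<close> times the squared norm.\<close>
    also have "\<dots> \<le> dotp n x (mulv n (?M e) x)"
    proof -
      have "dotp n x (mulv n (?M e) x) = dotp n x (mulv n ?A x) - dotp n x (mulv n (edge_mat (\<lambda>_. p)) x)"
        unfolding dotp_diff_right[symmetric] by (intro dotp_cong mulv_edge_mat_diff refl)
      moreover have "(\<Sum>i<n. x i) = 0" using x(1) by (simp add: dotp_def)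
      ultimately show ?thesis using p x(2) by (simp add: quadratic_form_const)
    qed
    finally show ?thesis using \<theta> x(2)
      by (intro trace_pow_ge[OF symm_edge_mat]) auto
  qed
  have "measure_pmf.prob (er_pmf n p) {A. ?\<theta> \<le> second_eigenvalue A}
      \<le> measure_pmf.prob (edge_pmf n (\<lambda>_ _. p)) {e. ?\<theta> ^ (2 * m) \<le> trace_pow n (?M e) (2 * m)}"
    unfolding prob_er_pmf using sub by (intro measure_pmf.finite_measure_mono) auto
  also have "\<dots> \<le> measure_pmf.expectation (edge_pmf n (\<lambda>_ _. p)) (\<lambda>e. trace_pow n (?M e) (2 * m)) / ?\<theta> ^ (2 * m)"
  proof (rule edge_pmf_Markov)
    fix e
    obtain v f where es: "eigensystem n (?M e) v f" using symmetric_eigensystem[OF symm_edge_mat] .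
    show "0 \<le> trace_pow n (?M e) (2 * m)"
      by (simp add: trace_pow_eigensystem[OF symm_edge_mat es] sum_nonneg)
  qed (use \<theta> in simp)
  also have "\<dots> \<le> 2 * (exp 1 * norm_const * real m) ^ m / ?\<theta> ^ (2 * m)"
    unfolding p_def using assms m \<theta> by (intro divide_right_mono er_trace_le) auto
  also have "\<dots> = 2 * (exp 1 * norm_const * real m / ?\<theta>\<^sup>2) ^ m"
    by (simp add: power_divide power_mult)
  also have "\<dots> \<le> 2 * (1 / 2) ^ m"
  proof (intro mult_left_mono power_mono)
    have "?\<theta>\<^sup>2 = 8 * exp 1 * norm_const * max (real k) (ln (real n))"
      using ln norm_const_pos by (simp add: power_mult_distrib test_const_def max_def)
    moreover have "exp 1 * norm_const * real m \<le> exp 1 * norm_const * (4 * max (real k) (ln (real n)))"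
      using m4 norm_const_pos by (intro mult_left_mono) auto
    ultimately have "exp 1 * norm_const * real m \<le> 1 / 2 * ?\<theta>\<^sup>2" by (simp add: mult_ac)
    then show "exp 1 * norm_const * real m / ?\<theta>\<^sup>2 \<le> 1 / 2"
      using \<theta> by (subst pos_divide_le_eq) auto
  qed (use norm_const_pos in auto)
  also have "\<dots> \<le> 2 * (1 / 2) ^ k" using m by (intro mult_left_mono power_decreasing) auto
  finally show ?thesis .
qed

subsection \<open>The ring lattice\<close>

definition lattice_adj :: "nat \<Rightarrow> nat \<Rightarrow> nat \<Rightarrow> nat \<Rightarrow> bool" where
  "lattice_adj n k i j \<longleftrightarrow> i \<noteq> j \<and> 2 * ring_dist n i j \<le> k"

lemma ring_lattice_entry:
  "i < n \<Longrightarrow> j < n \<Longrightarrow> ring_lattice n k $$ (i, j) = of_bool (lattice_adj n k i j)"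
  by (auto simp: ring_lattice_def lattice_adj_def)

lemma lattice_adj_sym: "lattice_adj n k i j = lattice_adj n k j i"
  by (auto simp: lattice_adj_def ring_dist_def abs_minus_commute)

lemma ring_dist_eq: "i \<le> j \<Longrightarrow> ring_dist n i j = min (j - i) (n - (j - i))"
  by (simp add: ring_dist_def Let_def nat_diff_distrib)

lemma lattice_degree:
  assumes "even k" "k < n" "i < n"
  shows "k \<le> card {j \<in> {..<n}. lattice_adj n k i j}"
proof -
  obtain h where k: "k = 2 * h" using assms(1) by auto
  \<comment> \<open>Offsets forward and backward along the ring; \<open>2 * h < n\<close> makes the
    two ranges disjoint and their images distinct.\<close>
  let ?D = "{1..h} \<union> {n - h..<n}"
  have "k = card ?D"
    using assms k by (subst card_Un_disjoint) auto
  also have "\<dots> = card ((\<lambda>d. (i + d) mod n) ` ?D)"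
  proof (rule card_image[symmetric], rule inj_onI)
    fix d d' assume "d \<in> ?D" "d' \<in> ?D" and eq: "(i + d) mod n = (i + d') mod n"
    then have "d < n" "d' < n" using assms k by auto
    then show "d = d'" using eq assms(3)
      by (auto simp: mod_if split: if_splits)
  qed
  also have "\<dots> \<le> card {j \<in> {..<n}. lattice_adj n k i j}"
  proof (rule card_mono)
    show "(\<lambda>d. (i + d) mod n) ` ?D \<subseteq> {j \<in> {..<n}. lattice_adj n k i j}"
    proof (rule image_subsetI)
      fix d assume d: "d \<in> ?D"
      then have dn: "d < n" "0 < d" and dh: "d \<le> h \<or> n - d \<le> h" using assms k by auto
      show "(i + d) mod n \<in> {j \<in> {..<n}. lattice_adj n k i j}"
      proof (cases "i + d < n")
        case True
        then show ?thesis using dn dh k by (auto simp: lattice_adj_def ring_dist_eq)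
      next
        case False
        then have j: "(i + d) mod n = i + d - n" using dn assms(3) by (simp add: mod_if)
        have "ring_dist n i (i + d - n) = ring_dist n (i + d - n) i"
          by (simp add: ring_dist_def abs_minus_commute)
        also have "\<dots> = min (n - d) d"
          using False dn assms(3) by (subst ring_dist_eq) auto
        finally show ?thesis using j False dn dh k assms(3)
          by (auto simp: lattice_adj_def)
      qed
    qed
  qed simp
  finally show ?thesis .
qed

lemma card_le_triangle:
  "card {(s, t). s + t < h} \<le> h * (h + 1) div 2" for h :: nat
proof -
  have "{(s, t). s + t < h} = (SIGMA s:{..<h}. {..<h - s})" by auto
  then have "card {(s, t). s + t < h} = (\<Sum>s<h. h - s)" by simp
  also have "\<dots> = h * (h + 1) div 2"
  proof (induction h)
    case (Suc h)
    have "(\<Sum>s<Suc h. Suc h - s) = Suc h + (\<Sum>s<h. h - s)"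
      by (subst sum.lessThan_Suc_shift) simp
    with Suc show ?case by simp
  qed simp
  finally show ?thesis by simp
qed

lemma finite_triangle: "finite {(s, t). s + t < (h::nat)}"
  by (rule finite_subset[of _ "{..h} \<times> {..h}"]) auto

text \<open>An adjacent pair separated by the cut at \<open>c\<close> is close to \<open>c\<close> or to the seam at \<open>0\<close>; either
  way it is described by a pair of offsets with small sum.\<close>

lemma card_crossing_le:
  "card {(i, j). i < c \<and> c \<le> j \<and> j < n \<and> lattice_adj n (2 * h) i j} \<le> h * (h + 1)"
proof -
  let ?T = "{(s, t). s + t < h}"
  have sub: "{(i, j). i < c \<and> c \<le> j \<and> j < n \<and> lattice_adj n (2 * h) i j}
    \<subseteq> (\<lambda>(s, t). (c - 1 - s, c + t)) ` ?T \<union> (\<lambda>(s, t). (s, n - 1 - t)) ` ?T"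
  proof (rule subsetI, clarify)
    fix i j assume ij: "i < c" "c \<le> j" "j < n" and adj: "lattice_adj n (2 * h) i j"
      and notin: "(i, j) \<notin> (\<lambda>(s, t). (s, n - 1 - t)) ` ?T"
    from adj ij have "j - i \<le> h \<or> n - (j - i) \<le> h"
      by (auto simp: lattice_adj_def ring_dist_eq min_le_iff_disj)
    then show "(i, j) \<in> (\<lambda>(s, t). (c - 1 - s, c + t)) ` ?T"
    proof
      assume "j - i \<le> h"
      then show ?thesis using ij by (intro image_eqI[of _ _ "(c - 1 - i, j - c)"]) auto
    next
      assume "n - (j - i) \<le> h"
      then have "(i, j) \<in> (\<lambda>(s, t). (s, n - 1 - t)) ` ?T"
        using ij by (intro image_eqI[of _ _ "(i, n - 1 - j)"]) auto
      with notin show ?thesis by simp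
    qed
  qed
  have "card {(i, j). i < c \<and> c \<le> j \<and> j < n \<and> lattice_adj n (2 * h) i j}
    \<le> card ((\<lambda>(s, t). (c - 1 - s, c + t)) ` ?T \<union> (\<lambda>(s, t). (s, n - 1 - t)) ` ?T)"
    using finite_triangle[of h] by (intro card_mono sub) auto
  also have "\<dots> \<le> card ((\<lambda>(s, t). (c - 1 - s, c + t)) ` ?T) + card ((\<lambda>(s, t). (s, n - 1 - t)) ` ?T)"
    by (rule card_Un_le)
  also have "\<dots> \<le> card ?T + card ?T"
    by (intro add_mono card_image_le finite_triangle)
  also have "\<dots> \<le> h * (h + 1)" using card_le_triangle[of h] by linarith
  finally show ?thesis .
qed

text \<open>Vectors that are constant on the two arcs \<open>{0, \<dots>, n div 2 - 1}\<close> and \<open>{n div 2, \<dots>, n - 1}\<close>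
  nearly attain the top eigenvalue \<open>k\<close>, since few lattice edges cross between the arcs:
  \<open>x\<^sub>i x\<^sub>j = (x\<^sub>i\<^sup>2 + x\<^sub>j\<^sup>2 - (x\<^sub>i - x\<^sub>j)\<^sup>2) / 2\<close>.\<close>

definition arc_vec :: "nat \<Rightarrow> real \<Rightarrow> real \<Rightarrow> nat \<Rightarrow> real" where
  "arc_vec n a b i = a * of_bool (i < n div 2) + b * of_bool (n div 2 \<le> i)"

lemma dotp_arc_vec:
  assumes "n \<ge> 1"
  shows "dotp n (arc_vec n a b) (arc_vec n a b) = real (n div 2) * a\<^sup>2 + real (n - n div 2) * b\<^sup>2"
proof -
  have "dotp n (arc_vec n a b) (arc_vec n a b) = (\<Sum>i<n. if i < n div 2 then a\<^sup>2 else b\<^sup>2)"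
    unfolding dotp_def by (intro sum.cong) (auto simp: arc_vec_def power2_eq_square)
  also have "\<dots> = (\<Sum>i\<in>{i \<in> {..<n}. i < n div 2}. a\<^sup>2) + (\<Sum>i\<in>{i \<in> {..<n}. \<not> i < n div 2}. b\<^sup>2)"
    by (simp add: sum.If_cases Int_def)
  also have "{i \<in> {..<n}. i < n div 2} = {..<n div 2}" by auto
  also have "{i \<in> {..<n}. \<not> i < n div 2} = {n div 2..<n}" by auto
  finally show ?thesis by simp
qed

lemma arc_size_bounds:
  "(real n - 1) / 2 \<le> real (n div 2)" "(real n - 1) / 2 \<le> real (n - n div 2)"
proof -
  have "n \<le> 2 * (n div 2) + 1" "n \<le> 2 * (n - n div 2) + 1" by linarith+
  then have "real n \<le> real (2 * (n div 2) + 1)" "real n \<le> real (2 * (n - n div 2) + 1)"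
    by (simp_all only: of_nat_le_iff)
  then show "(real n - 1) / 2 \<le> real (n div 2)" "(real n - 1) / 2 \<le> real (n - n div 2)"
    by (simp_all only: of_nat_add of_nat_mult) simp_all
qed

text \<open>Each arc has at least \<open>(n - 1) / 2\<close> nodes, so \<open>(a - b) ^ 2\<close> is
  at most \<open>4 / (n - 1)\<close> times the squared norm. Crossing pairs in both orders number at
  most \<open>2 h (h + 1) = k (k + 2) / 2\<close>; half the product is the relative loss
  \<open>(k + 2) / (n - 1)\<close>.\<close>

lemma lattice_arc_form_ge:
  fixes a b :: real
  assumes "even k" "k < n" "n \<ge> 2"
  defines "x \<equiv> arc_vec n a b"
  shows "real k * (1 - (real k + 2) / (real n - 1)) * dotp n x x
    \<le> (\<Sum>i<n. \<Sum>j<n. of_bool (lattice_adj n k i j) * x i * x j)"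
proof -
  obtain h where k: "k = 2 * h" using assms(1) by auto
  let ?B = "\<lambda>i j. of_bool (lattice_adj n k i j) :: real"
  let ?c = "n div 2"
  let ?X = "{(i, j). i < ?c \<and> ?c \<le> j \<and> j < n \<and> lattice_adj n k i j}"
  have "(\<Sum>i<n. \<Sum>j<n. ?B i j * (x j)\<^sup>2) = (\<Sum>i<n. \<Sum>j<n. ?B i j * (x i)\<^sup>2)"
    by (subst sum.swap) (simp add: lattice_adj_sym)
  moreover have "(\<Sum>i<n. \<Sum>j<n. ?B i j * x i * x j)
      = (\<Sum>i<n. \<Sum>j<n. (?B i j * (x i)\<^sup>2 + ?B i j * (x j)\<^sup>2 - ?B i j * (x i - x j)\<^sup>2) / 2)"
    by (intro sum.cong refl) (simp add: power2_diff field_simps)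
  then have "(\<Sum>i<n. \<Sum>j<n. ?B i j * x i * x j)
      = ((\<Sum>i<n. \<Sum>j<n. ?B i j * (x i)\<^sup>2) + (\<Sum>i<n. \<Sum>j<n. ?B i j * (x j)\<^sup>2)
        - (\<Sum>i<n. \<Sum>j<n. ?B i j * (x i - x j)\<^sup>2)) / 2"
    by (simp only: sum_divide_distrib[symmetric] sum.distrib sum_subtractf)
  ultimately have main: "(\<Sum>i<n. \<Sum>j<n. ?B i j * x i * x j)
      = (\<Sum>i<n. \<Sum>j<n. ?B i j * (x i)\<^sup>2) - (\<Sum>i<n. \<Sum>j<n. ?B i j * (x i - x j)\<^sup>2) / 2"
    by (simp only:) (simp add: field_simps)
  have "real k * dotp n x x = (\<Sum>i<n. real k * (x i)\<^sup>2)"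
    by (simp add: dotp_def sum_distrib_left power2_eq_square)
  also have "\<dots> \<le> (\<Sum>i<n. \<Sum>j<n. ?B i j * (x i)\<^sup>2)"
  proof (intro sum_mono)
    fix i assume "i \<in> {..<n}"
    then have "real k * (x i)\<^sup>2 \<le> real (card {j \<in> {..<n}. lattice_adj n k i j}) * (x i)\<^sup>2"
      using lattice_degree[OF assms(1,2)] by (intro mult_right_mono) auto
    also have "\<dots> = (\<Sum>j<n. ?B i j * (x i)\<^sup>2)"
      by (simp add: sum_distrib_right[symmetric] sum.If_cases of_bool_def Int_def)
    finally show "real k * (x i)\<^sup>2 \<le> (\<Sum>j<n. ?B i j * (x i)\<^sup>2)" .
  qed
  finally have deg: "real k * dotp n x x \<le> (\<Sum>i<n. \<Sum>j<n. ?B i j * (x i)\<^sup>2)" .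
  have x_if: "x i = (if i < ?c then a else b)" for i by (simp add: x_def arc_vec_def)
  have finX: "finite ?X" by (rule finite_subset[of _ "{..<n} \<times> {..<n}"]) auto
  have "(\<Sum>i<n. \<Sum>j<n. ?B i j * (x i - x j)\<^sup>2) = (\<Sum>(i, j)\<in>{..<n} \<times> {..<n}. ?B i j * (x i - x j)\<^sup>2)"
    by (rule sum.cartesian_product)
  \<comment> \<open>Differences within an arc vanish; only pairs across the cut remain, in either
    order.\<close>
  also have "\<dots> = (\<Sum>(i, j)\<in>?X \<union> prod.swap ` ?X. ?B i j * (x i - x j)\<^sup>2)"
    by (rule sum.mono_neutral_right) (auto simp: x_if image_iff lattice_adj_sym split: if_splits)
  also have "\<dots> = (\<Sum>p\<in>?X \<union> prod.swap ` ?X. (a - b)\<^sup>2)"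
    by (intro sum.cong refl) (auto simp: x_if lattice_adj_sym power2_commute)
  also have "\<dots> = real (card (?X \<union> prod.swap ` ?X)) * (a - b)\<^sup>2" by simp
  also have "\<dots> \<le> (real k * (real k + 2) / 2) * (a - b)\<^sup>2"
  proof (rule mult_right_mono)
    have "card (?X \<union> prod.swap ` ?X) \<le> card ?X + card (prod.swap ` ?X)" by (rule card_Un_le)
    also have "\<dots> \<le> card ?X + card ?X" by (intro add_left_mono card_image_le finX)
    also have "\<dots> \<le> 2 * (h * (h + 1))" using card_crossing_le[of ?c n h] by (simp add: k)
    finally have "real (card (?X \<union> prod.swap ` ?X)) \<le> real (2 * (h * (h + 1)))" by (rule of_nat_mono)
    also have "\<dots> = real k * (real k + 2) / 2" by (simp add: k field_simps)
    finally show "real (card (?X \<union> prod.swap ` ?X)) \<le> real k * (real k + 2) / 2" .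
  qed simp
  finally have cross: "(\<Sum>i<n. \<Sum>j<n. ?B i j * (x i - x j)\<^sup>2) \<le> (real k * (real k + 2) / 2) * (a - b)\<^sup>2" .
  note half = arc_size_bounds[of n]
  have "(a - b)\<^sup>2 \<le> 2 * (a\<^sup>2 + b\<^sup>2)"
    using zero_le_power2[of "a + b"] by (simp add: power2_sum power2_diff)
  then have "(real n - 1) / 2 * (a - b)\<^sup>2 \<le> (real n - 1) / 2 * (2 * (a\<^sup>2 + b\<^sup>2))"
    using assms(3) by (intro mult_left_mono) auto
  also have "\<dots> = 2 * ((real n - 1) / 2 * a\<^sup>2 + (real n - 1) / 2 * b\<^sup>2)" by (simp add: algebra_simps)
  also have "\<dots> \<le> 2 * dotp n x x"
    using mult_right_mono[OF half(1), of "a\<^sup>2"] mult_right_mono[OF half(2), of "b\<^sup>2"] assms(3)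
    unfolding x_def by (subst dotp_arc_vec) auto
  finally have "(a - b)\<^sup>2 \<le> 4 * dotp n x x / (real n - 1)"
    using assms(3) by (simp add: pos_le_divide_eq mult.commute)
  then have "(real k * (real k + 2) / 2) * (a - b)\<^sup>2 \<le> (real k * (real k + 2) / 2) * (4 * dotp n x x / (real n - 1))"
    by (intro mult_left_mono) auto
  moreover have "(real k * (real k + 2) / 2) * (4 * dotp n x x / (real n - 1))
      = 2 * (real k * (real k + 2) * dotp n x x / (real n - 1))" by simp
  ultimately have "(\<Sum>i<n. \<Sum>j<n. ?B i j * (x i - x j)\<^sup>2) / 2
      \<le> real k * (real k + 2) * dotp n x x / (real n - 1)" using cross by linarith
  moreover have "real k * (1 - (real k + 2) / (real n - 1)) * dotp n x x
      = real k * dotp n x x - real k * (real k + 2) * dotp n x x / (real n - 1)"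
    by (simp add: right_diff_distrib left_diff_distrib)
  ultimately show ?thesis using main deg by linarith
qed

subsection \<open>The Watts-Strogatz graph\<close>

text \<open>After division by \<open>n\<close> there are at most \<open>n ^ 2\<close> coefficients
  of size at most \<open>2 / n\<close>, hence a sum of squares at most 4 for every \<open>n\<close>;
  6 covers \<open>2 * exp (4 / 8)\<close>.\<close>

lemma bilinear_centred_tail:
  assumes "\<And>i j. 0 \<le> q i j \<and> q i j \<le> 1" "\<And>i. \<bar>f i\<bar> \<le> 1" "\<And>i. \<bar>g i\<bar> \<le> 1" "n > 0"
  shows "measure_pmf.prob (edge_pmf n q) {e. real n * t \<le>
      \<bar>dotp n f (mulv n (edge_mat (\<lambda>p. of_bool (e p) - q (fst p) (snd p))) g)\<bar>} \<le> 6 / exp t"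
proof -
  define a where "a = (\<lambda>(i, j). (f i * g j + f j * g i) / real n)"
  have "dotp n f (mulv n (edge_mat (\<lambda>p. of_bool (e p) - q (fst p) (snd p))) g)
      = real n * centred_sum n q a e" for e
    unfolding bilinear_edge_mat centred_sum_def sum_distrib_left
    using assms(4) by (intro sum.cong) (auto simp: a_def)
  then have "measure_pmf.prob (edge_pmf n q) {e. real n * t \<le>
      \<bar>dotp n f (mulv n (edge_mat (\<lambda>p. of_bool (e p) - q (fst p) (snd p))) g)\<bar>}
    = measure_pmf.prob (edge_pmf n q) {e. t \<le> \<bar>centred_sum n q a e\<bar>}"
    using assms(4) by (simp add: abs_mult)
  also have "\<dots> \<le> 2 * exp ((\<Sum>p\<in>upper_pairs n. (a p)\<^sup>2) / 8) / exp t"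
    by (rule centred_sum_tail[OF assms(1)])
  also have "\<dots> \<le> 2 * exp (4 / 8) / exp t"
  proof -
    have "(\<Sum>p\<in>upper_pairs n. (a p)\<^sup>2) \<le> (\<Sum>p\<in>upper_pairs n. (2 / real n)\<^sup>2)"
    proof (rule sum_mono)
      fix p assume "p \<in> upper_pairs n"
      obtain i j where p: "p = (i, j)" by (cases p)
      have "\<bar>f i * g j\<bar> \<le> 1" "\<bar>f j * g i\<bar> \<le> 1"
        using assms(2,3) by (auto simp: abs_mult intro!: mult_le_one)
      then have "\<bar>f i * g j + f j * g i\<bar> \<le> 2" by linarith
      then have "\<bar>a p\<bar> \<le> \<bar>2 / real n\<bar>" by (simp add: a_def p divide_right_mono)
      then show "(a p)\<^sup>2 \<le> (2 / real n)\<^sup>2" by (simp only: abs_le_square_iff)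
    qed
    also have "\<dots> \<le> real (n * n) * (2 / real n)\<^sup>2"
    proof -
      have "card (upper_pairs n) \<le> card ({..<n} \<times> {..<n})"
        by (intro card_mono) (auto simp: upper_pairs_def)
      then have "card (upper_pairs n) \<le> n * n" by simp
      then have "real (card (upper_pairs n)) \<le> real (n * n)" by (simp only: of_nat_le_iff)
      then show ?thesis by (simp only: sum_constant) (intro mult_right_mono, auto)
    qed
    also have "\<dots> = 4" using assms(4) by (simp add: power2_eq_square)
    finally show ?thesis by (intro divide_right_mono mult_left_mono) auto
  qed
  also have "\<dots> \<le> 6 / exp t"
  proof -
    have "exp (4 / 8) \<le> exp (1 :: real)" by simp
    also have "\<dots> \<le> 3" by (rule exp_le)
    finally show ?thesis by (intro divide_right_mono) auto
  qed
  finally show ?thesis .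
qed

definition ws_prob :: "nat \<Rightarrow> nat \<Rightarrow> real \<Rightarrow> (nat \<Rightarrow> nat) \<Rightarrow> nat \<Rightarrow> nat \<Rightarrow> real" where
  "ws_prob n k \<beta> \<pi> i j =
    (if relabel_mat n \<pi> (ring_lattice n k) $$ (i, j) = 1
     then 1 - \<beta> * (1 - \<beta> * (real k / (real n - 1))) else \<beta> * (real k / (real n - 1)))"

lemma prob_ws_pmf:
  "measure_pmf.prob (ws_pmf n k \<beta> \<pi>) S
    = measure_pmf.prob (edge_pmf n (ws_prob n k \<beta> \<pi>)) {e. sym_adj_mat n e \<in> S}"
  by (simp add: ws_pmf_def sym_bernoulli_pmf_def vimage_def ws_prob_def[abs_def])

lemma ws_prob_bounds:
  assumes "0 \<le> \<beta>" "\<beta> \<le> 1" "k < n"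
  shows "0 \<le> ws_prob n k \<beta> \<pi> i j \<and> ws_prob n k \<beta> \<pi> i j \<le> 1"
proof -
  define p where "p = real k / (real n - 1)"
  have "0 \<le> p" "p \<le> 1" using assms by (auto simp: p_def divide_le_eq_1)
  then have p: "0 \<le> \<beta> * p" "\<beta> * p \<le> 1" using assms(1,2) by (auto intro: mult_le_one)
  then have "0 \<le> \<beta> * (1 - \<beta> * p)" "\<beta> * (1 - \<beta> * p) \<le> 1"
    using assms(1,2) by (auto intro: mult_le_one)
  with p show ?thesis by (simp add: ws_prob_def p_def[symmetric])
qed

text \<open>By \<open>1 - \<beta> (1 - \<beta> p) = \<beta> p + (1 - \<beta>) (1 - \<beta>
  p)\<close> the mean is \<open>\<beta> p (J - I)\<close> plus a multiple of the relabelled lattice.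
  The all-ones matrix \<open>J\<close> has a nonnegative form, and \<open>- \<beta> p I\<close>
  costs at most the squared norm, whence the \<open>- 1\<close>.\<close>

lemma ws_mean_form_ge:
  fixes a b :: real
  assumes "\<pi> permutes {..<n}" "even k" "k < n" "n \<ge> 2" "0 \<le> \<beta>" "\<beta> \<le> 1"
  defines "x \<equiv> \<lambda>i. arc_vec n a b (inv_into UNIV \<pi> i)" and "p \<equiv> real k / (real n - 1)"
  shows "((1 - \<beta>) * (1 - \<beta> * p) * (real k * (1 - (real k + 2) / (real n - 1))) - 1) * dotp n x x
    \<le> dotp n x (mulv n (edge_mat (\<lambda>q. ws_prob n k \<beta> \<pi> (fst q) (snd q))) x)"
proof -
  have \<sigma>: "inv_into UNIV \<pi> permutes {..<n}" using assms(1) by (rule permutes_inv)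
  have \<sigma>_less: "inv_into UNIV \<pi> i < n \<longleftrightarrow> i < n" for i using permutes_in_image[OF \<sigma>, of i] by simp
  have \<sigma>_inj: "inv_into UNIV \<pi> i = inv_into UNIV \<pi> j \<longleftrightarrow> i = j" for i j
    using permutes_inj[OF \<sigma>] by (auto simp: inj_eq)
  let ?adj = "\<lambda>i j. of_bool (lattice_adj n k (inv_into UNIV \<pi> i) (inv_into UNIV \<pi> j)) :: real"
  have p: "0 \<le> p" "p \<le> 1" using assms by (auto simp: p_def divide_le_eq_1)
  have \<beta>p: "0 \<le> \<beta> * p" "\<beta> * p \<le> 1" using p assms(5,6) by (auto intro: mult_le_one)
  have entry: "edge_mat (\<lambda>q. ws_prob n k \<beta> \<pi> (fst q) (snd q)) i j
      = edge_mat (\<lambda>_. \<beta> * p) i j + (1 - \<beta>) * (1 - \<beta> * p) * ?adj i j" if "i < n" "j < n" for i j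
  proof (cases "i = j")
    case True
    then show ?thesis by (simp add: edge_mat_def lattice_adj_def)
  next
    case False
    have "ws_prob n k \<beta> \<pi> i j = \<beta> * p + (1 - \<beta>) * (1 - \<beta> * p) * ?adj i j" if "i < n" "j < n" for i j
      using that by (simp add: ws_prob_def relabel_mat_def ring_lattice_entry \<sigma>_less p_def[symmetric])
        (simp add: algebra_simps)
    from this[of "min i j" "max i j"] that False show ?thesis
      by (auto simp: edge_mat_def min_def max_def lattice_adj_sym)
  qed
  have "dotp n x (mulv n (edge_mat (\<lambda>q. ws_prob n k \<beta> \<pi> (fst q) (snd q))) x)
      = dotp n x (mulv n (edge_mat (\<lambda>_. \<beta> * p)) x)
        + (1 - \<beta>) * (1 - \<beta> * p) * (\<Sum>i<n. \<Sum>j<n. ?adj i j * x i * x j)"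
    by (simp add: dotp_def mulv_def entry sum_distrib_left distrib_left distrib_right sum.distrib mult_ac)
  also have "(\<Sum>i<n. \<Sum>j<n. ?adj i j * x i * x j)
      = (\<Sum>i<n. \<Sum>j<n. of_bool (lattice_adj n k i j) * arc_vec n a b i * arc_vec n a b j)"
  proof -
    have "(\<Sum>i<n. \<Sum>j<n. of_bool (lattice_adj n k i j) * arc_vec n a b i * arc_vec n a b j)
      = (\<Sum>i<n. \<Sum>j<n. of_bool (lattice_adj n k (inv_into UNIV \<pi> i) j) * arc_vec n a b (inv_into UNIV \<pi> i) * arc_vec n a b j)"
      by (subst sum.permute[OF \<sigma>]) (simp add: o_def)
    also have "\<dots> = (\<Sum>i<n. \<Sum>j<n. ?adj i j * x i * x j)"
      by (rule sum.cong[OF refl], subst sum.permute[OF \<sigma>]) (simp add: o_def x_def)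
    finally show ?thesis ..
  qed
  finally have form: "dotp n x (mulv n (edge_mat (\<lambda>q. ws_prob n k \<beta> \<pi> (fst q) (snd q))) x)
      = \<beta> * p * ((\<Sum>i<n. x i)\<^sup>2 - dotp n x x) + (1 - \<beta>) * (1 - \<beta> * p) *
        (\<Sum>i<n. \<Sum>j<n. of_bool (lattice_adj n k i j) * arc_vec n a b i * arc_vec n a b j)"
    by (simp add: quadratic_form_const)
  have xx: "dotp n x x = dotp n (arc_vec n a b) (arc_vec n a b)"
    unfolding dotp_def x_def by (subst (2) sum.permute[OF \<sigma>]) (simp add: o_def)
  have "(1 - \<beta>) * (1 - \<beta> * p) * (real k * (1 - (real k + 2) / (real n - 1)) * dotp n x x)
    \<le> (1 - \<beta>) * (1 - \<beta> * p) *
        (\<Sum>i<n. \<Sum>j<n. of_bool (lattice_adj n k i j) * arc_vec n a b i * arc_vec n a b j)"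
    unfolding xx using assms \<beta>p by (intro mult_left_mono lattice_arc_form_ge) auto
  moreover have "- dotp n x x \<le> \<beta> * p * ((\<Sum>i<n. x i)\<^sup>2 - dotp n x x)"
  proof -
    have "\<beta> * p * dotp n x x \<le> 1 * dotp n x x" using \<beta>p by (intro mult_right_mono dotp_nonneg)
    moreover have "0 \<le> \<beta> * p * (\<Sum>i<n. x i)\<^sup>2" by (rule mult_nonneg_nonneg[OF \<beta>p(1)]) simp
    ultimately show ?thesis by (simp add: algebra_simps)
  qed
  ultimately show ?thesis unfolding form by (simp add: algebra_simps)
qed

text \<open>If the three forms of the noise on \<open>f\<close> and \<open>g\<close> are at most
  \<open>n t\<close>, then on \<open>a f + b g\<close> it is at most
  \<open>2 n t (a ^ 2 + b ^ 2)\<close>, and \<open>n (a ^ 2 + b ^ 2)\<close> is at most 4 times the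
  squared norm: hence \<open>8 * t\<close>. The bound is uniform in the hidden permutation, so
  averaging over permutations is harmless.\<close>

lemma ws_second_eigenvalue_tail:
  assumes \<pi>: "\<pi> permutes {..<n}" and "even k" "k < n" "n \<ge> 2" "0 \<le> \<beta>" "\<beta> \<le> 1" "t \<ge> 0"
  defines "l \<equiv> (1 - \<beta>) * (1 - \<beta> * (real k / (real n - 1))) * (real k * (1 - (real k + 2) / (real n - 1)))"
  shows "measure_pmf.prob (ws_pmf n k \<beta> \<pi>) {A. second_eigenvalue A < l - 1 - 8 * t} \<le> 18 / exp t"
proof -
  define f g where "f = (\<lambda>i. arc_vec n 1 0 (inv_into UNIV \<pi> i))" and "g = (\<lambda>i. arc_vec n 0 1 (inv_into UNIV \<pi> i))"
  have fg: "\<bar>f i\<bar> \<le> 1" "\<bar>g i\<bar> \<le> 1" for i by (auto simp: f_def g_def arc_vec_def)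
  have x_eq: "(\<lambda>i. a * f i + b * g i) = (\<lambda>i. arc_vec n a b (inv_into UNIV \<pi> i))" for a b
    by (auto simp: f_def g_def arc_vec_def)
  let ?q = "ws_prob n k \<beta> \<pi>"
  let ?M = "\<lambda>e. edge_mat (\<lambda>p. of_bool (e p) - ?q (fst p) (snd p))"
  let ?A = "\<lambda>e. edge_mat (\<lambda>p. of_bool (e p))"
  define bad where "bad u w = {e. real n * t \<le> \<bar>dotp n u (mulv n (?M e) w)\<bar>}" for u w
  have xx: "dotp n (\<lambda>i. arc_vec n a b (inv_into UNIV \<pi> i)) (\<lambda>i. arc_vec n a b (inv_into UNIV \<pi> i))
      = real (n div 2) * a\<^sup>2 + real (n - n div 2) * b\<^sup>2" for a b
  proof -
    have "dotp n (arc_vec n a b) (arc_vec n a b)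
        = dotp n (\<lambda>i. arc_vec n a b (inv_into UNIV \<pi> i)) (\<lambda>i. arc_vec n a b (inv_into UNIV \<pi> i))"
      unfolding dotp_def by (subst sum.permute[OF permutes_inv[OF \<pi>]]) (simp add: o_def)
    then show ?thesis using assms(4) by (simp add: dotp_arc_vec)
  qed
  have good: "l - 1 - 8 * t \<le> second_eigenvalue (sym_adj_mat n e)"
    if "e \<notin> bad f f" "e \<notin> bad f g" "e \<notin> bad g g" for e
  proof -
    let ?S11 = "dotp n f (mulv n (?M e) f)" and ?S12 = "dotp n f (mulv n (?M e) g)"
    let ?S22 = "dotp n g (mulv n (?M e) g)"
    have S: "\<bar>?S11\<bar> \<le> real n * t" "\<bar>?S12\<bar> \<le> real n * t" "\<bar>?S22\<bar> \<le> real n * t"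
      using that by (auto simp: bad_def)
    have "l - 1 - 8 * t \<le> second_eigenvalue (mat n n (\<lambda>(i, j). ?A e i j))"
    proof (rule second_eigenvalue_ge[OF symm_edge_mat assms(4), where f = f and g = g])
      fix a b x assume x: "x = (\<lambda>i. a * f i + b * g i)"
      note half = arc_size_bounds[of n]
      have norm: "dotp n x x = real (n div 2) * a\<^sup>2 + real (n - n div 2) * b\<^sup>2"
        unfolding x x_eq by (rule xx)
      have "(real n - 1) / 2 * (a\<^sup>2 + b\<^sup>2) \<le> dotp n x x"
        unfolding norm distrib_left using half by (intro add_mono mult_right_mono) auto
      moreover have "real n / 4 * (a\<^sup>2 + b\<^sup>2) \<le> (real n - 1) / 2 * (a\<^sup>2 + b\<^sup>2)"
        using assms(4) by (intro mult_right_mono) auto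
      ultimately have ab: "real n * (a\<^sup>2 + b\<^sup>2) \<le> 4 * dotp n x x" by linarith
      have "dotp n x (mulv n (?M e) x) = a\<^sup>2 * ?S11 + 2 * (a * b) * ?S12 + b\<^sup>2 * ?S22"
      proof -
        have "dotp n g (mulv n (?M e) f) = ?S12"
          by (subst symm_dotp_mulv[OF symm_edge_mat]) (rule dotp_commute)
        then show ?thesis
          unfolding x by (simp add: mulv_add mulv_scale dotp_linear power2_eq_square algebra_simps)
      qed
      also have "\<bar>\<dots>\<bar> \<le> a\<^sup>2 * (real n * t) + (a\<^sup>2 + b\<^sup>2) * (real n * t) + b\<^sup>2 * (real n * t)"
      proof -
        have "\<bar>a\<^sup>2 * ?S11\<bar> \<le> a\<^sup>2 * (real n * t)" "\<bar>b\<^sup>2 * ?S22\<bar> \<le> b\<^sup>2 * (real n * t)"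
          using S by (auto simp: abs_mult intro: mult_left_mono)
        moreover have "\<bar>2 * (a * b) * ?S12\<bar> \<le> (a\<^sup>2 + b\<^sup>2) * (real n * t)"
        proof -
          have "\<bar>2 * (a * b)\<bar> \<le> a\<^sup>2 + b\<^sup>2"
            using zero_le_power2[of "a - b"] zero_le_power2[of "a + b"]
            by (simp add: power2_sum power2_diff abs_le_iff)
          then show ?thesis unfolding abs_mult[of "2 * (a * b)"] using S(2) by (intro mult_mono) auto
        qed
        ultimately show ?thesis by linarith
      qed
      also have "\<dots> = 2 * t * (real n * (a\<^sup>2 + b\<^sup>2))" by (simp add: algebra_simps)
      also have "\<dots> \<le> 2 * t * (4 * dotp n x x)" using ab assms(7) by (intro mult_left_mono) auto
      finally have fluct: "\<bar>dotp n x (mulv n (?M e) x)\<bar> \<le> 8 * t * dotp n x x" by simp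
      have "dotp n x (mulv n (?M e) x) = dotp n x (mulv n (?A e) x)
          - dotp n x (mulv n (edge_mat (\<lambda>p. ?q (fst p) (snd p))) x)"
        unfolding dotp_diff_right[symmetric] by (intro dotp_cong mulv_edge_mat_diff refl)
      moreover have "(l - 1) * dotp n x x \<le> dotp n x (mulv n (edge_mat (\<lambda>p. ?q (fst p) (snd p))) x)"
        unfolding l_def x x_eq by (rule ws_mean_form_ge[OF assms(1-6)])
      ultimately show "(l - 1 - 8 * t) * dotp n x x \<le> dotp n x (mulv n (?A e) x)"
        using fluct by (simp add: left_diff_distrib abs_le_iff)
    next
      fix a b x assume x: "x = (\<lambda>i. a * f i + b * g i)" and "dotp n x x = 0"
      then have "real (n div 2) * a\<^sup>2 + real (n - n div 2) * b\<^sup>2 = 0" by (simp add: x_eq xx)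
      moreover have "real (n div 2) > 0" "real (n - n div 2) > 0" using assms(4) by auto
      ultimately show "a = 0 \<and> b = 0"
        by (smt (verit) mult_pos_pos mult_nonneg_nonneg zero_le_power2 zero_less_power2)
    qed
    then show ?thesis by (simp add: sym_adj_mat_edge_mat)
  qed
  have "measure_pmf.prob (ws_pmf n k \<beta> \<pi>) {A. second_eigenvalue A < l - 1 - 8 * t}
      \<le> measure_pmf.prob (edge_pmf n ?q) (bad f f \<union> bad f g \<union> bad g g)"
    unfolding prob_ws_pmf using good by (intro measure_pmf.finite_measure_mono) (auto simp: not_le[symmetric])
  also have "\<dots> \<le> measure_pmf.prob (edge_pmf n ?q) (bad f f) + measure_pmf.prob (edge_pmf n ?q) (bad f g)
      + measure_pmf.prob (edge_pmf n ?q) (bad g g)"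
    by (intro order_trans[OF measure_Un_le] add_right_mono measure_Un_le) auto
  also have "\<dots> \<le> 6 / exp t + 6 / exp t + 6 / exp t"
    unfolding bad_def using assms fg
    by (intro add_mono bilinear_centred_tail ws_prob_bounds) auto
  finally show ?thesis by simp
qed

section \<open>Error probabilities of the test\<close>

lemma card_hidden_perms_le:
  assumes "n \<ge> 1"
  shows "card (hidden_perms n) \<le> fact (n - 1)"
proof -
  have sub: "hidden_perms n \<subseteq> {\<pi>. \<pi> permutes {1..<n}}"
  proof
    fix \<pi> assume "\<pi> \<in> hidden_perms n"
    then show "\<pi> \<in> {\<pi>. \<pi> permutes {1..<n}}"
      unfolding hidden_perms_def by (auto simp: Suc_le_eq intro!: permutes_superset[of \<pi> "{..<n}"])
  qed
  have fin: "finite {\<pi>. \<pi> permutes {1..<n}}" by (rule finite_permutations) simp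
  have "card {\<pi>. \<pi> permutes {1..<n}} = fact (n - 1)" by (rule card_permutations) auto
  with card_mono[OF fin sub] show "card (hidden_perms n) \<le> fact (n - 1)" by simp
qed

text \<open>Both loss factors, \<open>1 - \<beta> p\<close> and
  \<open>1 - (k + 2) / (n - 1)\<close>, are at least \<open>(1 - \<rho>) / 2\<close>; the square of
  this in the signal condition cancels them. In \<open>test_const + 9\<close> the 9 is 8 for the
  fluctuations at \<open>t = sqrt k\<close> and 1 for the \<open>- 1\<close> of the mean form, as
  \<open>1 <= sqrt k\<close>.\<close>

lemma spectral_test_error_le:
  assumes \<rho>: "0 < \<rho>" "\<rho> < 1"
    and "even k" "0 \<le> \<beta>" "\<beta> \<le> 1" "1 \<le> k" "real k \<le> \<rho> * real n" "6 / (1 - \<rho>) \<le> real n"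
    and signal: "(test_const + 9) / ((1 - \<rho>) / 2)\<^sup>2 * max (sqrt (1 / real k)) (sqrt (ln (real n)) / real k) \<le> 1 - \<beta>"
  shows "max (measure_pmf.prob (er_pmf n (real k / (real n - 1))) {A. spectral_test test_const n k A \<noteq> 0})
      (1 / fact (n - 1) * (\<Sum>\<pi>\<in>hidden_perms n.
         measure_pmf.prob (ws_pmf n k \<beta> \<pi>) {A. spectral_test test_const n k A \<noteq> 1}))
    \<le> 2 * (1 / 2) ^ k + 18 / exp (sqrt (real k))"
proof -
  define \<eta> where "\<eta> = (1 - \<rho>) / 2"
  have \<eta>: "\<eta> > 0" using \<rho> by (simp add: \<eta>_def)
  have n6: "6 \<le> real n * (1 - \<rho>)" using assms(8) \<rho> by (simp add: pos_divide_le_eq)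
  also have "\<dots> \<le> real n * 1" using \<rho> by (intro mult_left_mono) auto
  finally have "n \<ge> 6" by simp
  \<comment> \<open>Multiplied out, this needs
    \<open>n (1 - \<rho>) / 2 >= 2 + (1 + \<rho>) / 2\<close>; the 6 makes the left side at least
    3.\<close>
  have "(real k + 2) \<le> (1 - \<eta>) * (real n - 1)"
    using assms(7) n6 \<rho> by (simp add: \<eta>_def field_simps)
  then have k2: "(real k + 2) / (real n - 1) \<le> 1 - \<eta>" using \<open>n \<ge> 6\<close> by (simp add: pos_divide_le_eq)
  have "real k / (real n - 1) \<le> (real k + 2) / (real n - 1)"
    using \<open>n \<ge> 6\<close> by (intro divide_right_mono) auto
  with k2 have p: "real k / (real n - 1) \<le> 1 - \<eta>" by linarith
  have "real k < real n - 1"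
  proof -
    have "real k \<le> (1 - \<eta>) * (real n - 1)" using p \<open>n \<ge> 6\<close> by (simp add: pos_divide_le_eq)
    also have "\<dots> < 1 * (real n - 1)" using \<eta> \<open>n \<ge> 6\<close> by (intro mult_strict_right_mono) auto
    finally show ?thesis by simp
  qed
  then have kn: "k < n" by linarith
  let ?m = "max (sqrt (real k)) (sqrt (ln (real n)))"
  \<comment> \<open>It must tend to infinity for \<open>18 / exp t\<close> to vanish, yet stay below
    the scale \<open>?m\<close> of the threshold.\<close>
  let ?t = "sqrt (real k)"
  have er: "measure_pmf.prob (er_pmf n (real k / (real n - 1))) {A. spectral_test test_const n k A \<noteq> 0}
      \<le> 2 * (1 / 2) ^ k"
    using er_second_eigenvalue_tail[of k n] assms(6) kn by (simp add: spectral_test_def)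
  have ws: "measure_pmf.prob (ws_pmf n k \<beta> \<pi>) {A. spectral_test test_const n k A \<noteq> 1} \<le> 18 / exp ?t"
    if "\<pi> \<in> hidden_perms n" for \<pi>
  proof -
    define l where "l = (1 - \<beta>) * (1 - \<beta> * (real k / (real n - 1)))
      * (real k * (1 - (real k + 2) / (real n - 1)))"
    have \<pi>: "\<pi> permutes {..<n}" using that by (simp add: hidden_perms_def)
    have "(test_const + 9) * ?m \<le> \<eta>\<^sup>2 * ((1 - \<beta>) * real k)"
    proof -
      have "max (sqrt (1 / real k)) (sqrt (ln (real n)) / real k) * real k
          = max (sqrt (1 / real k) * real k) (sqrt (ln (real n)) / real k * real k)"
        by (simp only: max_mult_distrib_right of_nat_0_le_iff if_True)
      also have "sqrt (1 / real k) * real k = real k / sqrt (real k)" by (simp add: real_sqrt_divide)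
      also have "\<dots> = sqrt (real k)" by (simp add: real_div_sqrt)
      finally have m: "max (sqrt (1 / real k)) (sqrt (ln (real n)) / real k) * real k = ?m"
        using assms(6) by simp
      have "(test_const + 9) / \<eta>\<^sup>2 * max (sqrt (1 / real k)) (sqrt (ln (real n)) / real k) * real k
          \<le> (1 - \<beta>) * real k"
        using signal by (intro mult_right_mono) (auto simp: \<eta>_def)
      then have "(test_const + 9) / \<eta>\<^sup>2 * ?m \<le> (1 - \<beta>) * real k"
        by (simp only: mult.assoc m)
      then show ?thesis using \<eta> by (simp add: field_simps)
    qed
    also have "\<eta>\<^sup>2 * ((1 - \<beta>) * real k) \<le> l"
    proof -
      have "\<beta> * (real k / (real n - 1)) \<le> 1 * (1 - \<eta>)"
        using p assms(4,5) \<open>n \<ge> 6\<close> by (intro mult_mono) auto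
      then have "\<eta> * \<eta> \<le> (1 - \<beta> * (real k / (real n - 1))) * (1 - (real k + 2) / (real n - 1))"
        using k2 \<eta> by (intro mult_mono) auto
      then have "\<eta> * \<eta> * ((1 - \<beta>) * real k) \<le> (1 - \<beta> * (real k / (real n - 1)))
          * (1 - (real k + 2) / (real n - 1)) * ((1 - \<beta>) * real k)"
        using assms(5) by (intro mult_right_mono) auto
      then show ?thesis by (simp only: l_def power2_eq_square mult_ac)
    qed
    finally have "(test_const + 9) * ?m \<le> l" .
    moreover have "1 \<le> ?t" "?t \<le> ?m" using assms(6) by auto
    ultimately have l: "test_const * ?m \<le> l - 1 - 8 * ?t"
      unfolding distrib_right by linarith
    have "measure_pmf.prob (ws_pmf n k \<beta> \<pi>) {A. spectral_test test_const n k A \<noteq> 1}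
        \<le> measure_pmf.prob (ws_pmf n k \<beta> \<pi>) {A. second_eigenvalue A < l - 1 - 8 * ?t}"
      using l by (intro measure_pmf.finite_measure_mono) (auto simp: spectral_test_def split: if_splits)
    also have "\<dots> \<le> 18 / exp ?t"
      unfolding l_def using assms kn \<open>n \<ge> 6\<close> by (intro ws_second_eigenvalue_tail \<pi>) auto
    finally show ?thesis .
  qed
  have "(\<Sum>\<pi>\<in>hidden_perms n. measure_pmf.prob (ws_pmf n k \<beta> \<pi>) {A. spectral_test test_const n k A \<noteq> 1})
      \<le> real (card (hidden_perms n)) * (18 / exp ?t)"
    by (rule sum_bounded_above) (rule ws)
  also have "\<dots> \<le> fact (n - 1) * (18 / exp ?t)"
  proof (rule mult_right_mono)
    have "real (card (hidden_perms n)) \<le> real (fact (n - 1))"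
      using card_hidden_perms_le[of n] \<open>n \<ge> 6\<close> by (simp only: of_nat_le_iff)
    then show "real (card (hidden_perms n)) \<le> fact (n - 1)" by simp
  qed simp
  finally have "1 / fact (n - 1) * (\<Sum>\<pi>\<in>hidden_perms n. measure_pmf.prob (ws_pmf n k \<beta> \<pi>)
      {A. spectral_test test_const n k A \<noteq> 1}) \<le> 18 / exp ?t"
    by (simp add: pos_divide_le_eq mult.commute)
  moreover have "0 \<le> 2 * (1 / 2 :: real) ^ k" "0 \<le> 18 / exp ?t" by simp_all
  ultimately show ?thesis using er by (intro max.boundedI) linarith+
qed

text \<open>The bound \<open>k <= \<rho> n\<close> keeps the models apart: for
  \<open>k = n - 1\<close> and \<open>\<beta> = 0\<close> both are the complete graph. The threshold
  constant \<open>C\<close> is governed by the null hypothesis and precedes \<rho>; \<open>c\<close>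
  follows it, because the guaranteed signal shrinks with \<open>1 - \<rho>\<close>.\<close>

theorem lemma2:
  shows "\<exists>C>0. \<forall>\<rho>::real. 0 < \<rho> \<and> \<rho> < 1 \<longrightarrow> (\<exists>c>0.
    \<forall>(k :: nat \<Rightarrow> nat) (\<beta> :: nat \<Rightarrow> real).
      filterlim k at_top sequentially \<and>
      (\<forall>n. even (k n)) \<and>
      (\<forall>n. 0 \<le> \<beta> n \<and> \<beta> n \<le> 1) \<and>
      (\<forall>\<^sub>F n in sequentially. real (k n) \<le> \<rho> * real n) \<and>
      (\<forall>\<^sub>F n in sequentially.
         1 - \<beta> n \<ge> c * max (sqrt (1 / real (k n))) (sqrt (ln (real n)) / real (k n)))
      \<longrightarrow>
      (\<lambda>n. max
         (measure_pmf.prob (er_pmf n (real (k n) / (real n - 1)))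
            {A. spectral_test C n (k n) A \<noteq> 0})
         (1 / fact (n - 1) *
            (\<Sum>\<pi>\<in>hidden_perms n.
               measure_pmf.prob (ws_pmf n (k n) (\<beta> n) \<pi>)
                 {A. spectral_test C n (k n) A \<noteq> 1})))
      \<longlonglongrightarrow> 0)"
proof (rule exI[of _ test_const], intro conjI test_const_pos allI impI)
  fix \<rho> :: real
  assume \<rho>: "0 < \<rho> \<and> \<rho> < 1"
  let ?c = "(test_const + 9) / ((1 - \<rho>) / 2)\<^sup>2"
  show "\<exists>c>0. \<forall>(k :: nat \<Rightarrow> nat) (\<beta> :: nat \<Rightarrow> real).
      filterlim k at_top sequentially \<and>
      (\<forall>n. even (k n)) \<and>
      (\<forall>n. 0 \<le> \<beta> n \<and> \<beta> n \<le> 1) \<and>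
      (\<forall>\<^sub>F n in sequentially. real (k n) \<le> \<rho> * real n) \<and>
      (\<forall>\<^sub>F n in sequentially.
         1 - \<beta> n \<ge> c * max (sqrt (1 / real (k n))) (sqrt (ln (real n)) / real (k n)))
      \<longrightarrow>
      (\<lambda>n. max
         (measure_pmf.prob (er_pmf n (real (k n) / (real n - 1)))
            {A. spectral_test test_const n (k n) A \<noteq> 0})
         (1 / fact (n - 1) *
            (\<Sum>\<pi>\<in>hidden_perms n.
               measure_pmf.prob (ws_pmf n (k n) (\<beta> n) \<pi>)
                 {A. spectral_test test_const n (k n) A \<noteq> 1})))
      \<longlonglongrightarrow> 0"
  proof (rule exI[of _ ?c], intro conjI allI impI)
    show "?c > 0" using \<rho> test_const_pos by (auto intro!: divide_pos_pos)
    fix k :: "nat \<Rightarrow> nat" and \<beta> :: "nat \<Rightarrow> real"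
    assume *: "filterlim k at_top sequentially \<and>
      (\<forall>n. even (k n)) \<and>
      (\<forall>n. 0 \<le> \<beta> n \<and> \<beta> n \<le> 1) \<and>
      (\<forall>\<^sub>F n in sequentially. real (k n) \<le> \<rho> * real n) \<and>
      (\<forall>\<^sub>F n in sequentially.
         1 - \<beta> n \<ge> ?c * max (sqrt (1 / real (k n))) (sqrt (ln (real n)) / real (k n)))"
    then have k: "filterlim k at_top sequentially" and even: "\<forall>n. even (k n)"
      and \<beta>: "\<forall>n. 0 \<le> \<beta> n \<and> \<beta> n \<le> 1"
      and k_le: "\<forall>\<^sub>F n in sequentially. real (k n) \<le> \<rho> * real n"
      and signal: "\<forall>\<^sub>F n in sequentially.
        1 - \<beta> n \<ge> ?c * max (sqrt (1 / real (k n))) (sqrt (ln (real n)) / real (k n))"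
      by blast+
    let ?err = "\<lambda>n. max
         (measure_pmf.prob (er_pmf n (real (k n) / (real n - 1)))
            {A. spectral_test test_const n (k n) A \<noteq> 0})
         (1 / fact (n - 1) *
            (\<Sum>\<pi>\<in>hidden_perms n.
               measure_pmf.prob (ws_pmf n (k n) (\<beta> n) \<pi>)
                 {A. spectral_test test_const n (k n) A \<noteq> 1}))"
    have "(\<lambda>j. 2 * (1 / 2) ^ j + 18 / exp (sqrt (real j))) \<longlonglongrightarrow> 0"
      by real_asymp
    then have lim: "(\<lambda>n. 2 * (1 / 2) ^ k n + 18 / exp (sqrt (real (k n)))) \<longlonglongrightarrow> 0"
      by (rule filterlim_compose[OF _ k])
    have "\<forall>\<^sub>F n in sequentially. 1 \<le> k n"
      using k by (simp add: filterlim_at_top)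
    moreover have "\<forall>\<^sub>F n in sequentially. 6 / (1 - \<rho>) \<le> real n" by real_asymp
    ultimately have "\<forall>\<^sub>F n in sequentially. ?err n \<le> 2 * (1 / 2) ^ k n + 18 / exp (sqrt (real (k n)))"
      using k_le signal
    proof eventually_elim
      case (elim n)
      with \<rho> even \<beta> show ?case by (intro spectral_test_error_le[of \<rho>]) auto
    qed
    moreover have "\<forall>\<^sub>F n in sequentially. 0 \<le> ?err n"
      by (intro always_eventually allI) (simp add: le_max_iff_disj)
    ultimately show "?err \<longlonglongrightarrow> 0"
      by (intro tendsto_sandwich[OF _ _ tendsto_const lim]) auto
  qed
qed

end
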